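(* Let $R=k[[\alpha_1t^{a_1},\dots,\alpha_nt^{a_n}]]$ be a one-dimensional complete local domain as in the context, with conductor $\mathfrak{C}_R\subseteq\mathfrak{m}_R^2$, and let $x_1=\alpha_1t^{a_1}$. Let $S=R\left[\frac{\mathfrak{C}_R}{x_1}\right]$. If $S$ is quasi-homogeneous, then $\tau(\Omega_R)$ is nonzero.
   Context: $k$ is an algebraically closed field of characteristic $0$; $(R,\mathfrak{m}_R,k)$ is a one-dimensional complete equicharacteristic local $k$-algebra which is a domain, with residue field $k$, fraction field $Q$, integral closure $\overline{R}=k[[t]]$ and embedding dimension $n$. The elements $x_i=\alpha_it^{a_i}$, $1\le i\le n$, are minimal generators of $\mathfrak{m}_R$, with $\alpha_i$ units of $\overline{R}$ and $a_1\le\cdots\le a_n$. The conductor is $\mathfrak{C}_R=\{q\in Q:q\overline{R}\subseteq R\}$. $S=R[\frac{\mathfrak{C}_R}{x_1}]$ is the subring of $\overline{R}$ generated over $R$ by the set $\frac{\mathfrak{C}_R}{x_1}=\{\frac{z}{x_1}:z\in\mathfrak{C}_R\}$; it is again a complete local $k$-algebra. A complete local $k$-algebra is called quasi-homogeneous if it is isomorphic to a quotient $k[[Y_1,\dots,Y_m]]/J$ where $J$ is generated by polynomials that are homogeneous with respect to some assignment of positive integer weights to $Y_1,\dots,Y_m$. Write $R=k[[X_1,\dots,X_n]]/I$ with $I=(f_1,\dots,f_m)\subseteq (X_1,\dots,X_n)^2$, $X_i\mapsto x_i$. The universally finite module of differentials $\Omega_R$ is the cokernel of the Jacobian matrix $R^m\xrightarrow{[\partial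 f_j/\partial x_i]}R^n$; $\tau(\Omega_R)$ is its torsion submodule. *)

theory Defs
  imports
    "HOL-Computational_Algebra.Computational_Algebra"
    "HOL-Library.Poly_Mapping"
    "HOL-Library.Groups_Big_Fun"
    "HOL-Algebra.Algebra"
    "HOL-Algebra.Algebraic_Closure_Type"
    "Jordan_Normal_Form.Matrix"
begin

section \<open>Formal power series in several variables\<close>

text \<open>A power series is given by its coefficients, indexed by exponent vectors. The variables
  are \<open>X\<^sub>0, X\<^sub>1, \<dots>\<close>; the ring \<open>mps_ring n\<close> is \<open>k[[X\<^sub>0, \<dots>, X\<^bsub>n-1\<^esub>]]\<close>.\<close>

type_synonym 'k mps = "(nat \<Rightarrow>\<^sub>0 nat) \<Rightarrow> 'k"

definition mps_const :: "'k::zero \<Rightarrow> 'k mps" where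
  "mps_const c = (\<lambda>u. if u = 0 then c else 0)"

definition mps_var :: "nat \<Rightarrow> 'k::zero_neq_one mps" where
  "mps_var i = (\<lambda>u. if u = Poly_Mapping.single i 1 then 1 else 0)"

definition mps_mult :: "'k::comm_ring_1 mps \<Rightarrow> 'k mps \<Rightarrow> 'k mps" where
  "mps_mult F G = (\<lambda>u. \<Sum>(v, w)\<in>{(v, w). v + w = u}. F v * G w)"

definition mps_ring :: "nat \<Rightarrow> 'k::comm_ring_1 mps ring" where
  "mps_ring n =
    \<lparr> carrier = {F. \<forall>u. F u \<noteq> 0 \<longrightarrow> Poly_Mapping.keys u \<subseteq> {..<n}},
      monoid.mult = mps_mult,
      one = mps_const 1,
      ring.zero = (\<lambda>_. 0),
      ring.add = (\<lambda>F G u. F u + G u) \<rparr>"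

lemma finite_splits: "finite {(v, w). v + w = (u::nat \<Rightarrow>\<^sub>0 nat)}"
proof -
  let ?K = "Poly_Mapping.keys u"
  let ?B = "{f. \<forall>i. (i \<in> ?K \<longrightarrow> f i \<in> {..Max (insert 0 (Poly_Mapping.lookup u ` ?K))}) \<and> (i \<notin> ?K \<longrightarrow> f i = (0::nat))}"
  have fB: "finite ?B" by (rule finite_set_of_finite_funs) auto
  have le: "Poly_Mapping.lookup v \<in> ?B" if "v + w = u" for v w :: "nat \<Rightarrow>\<^sub>0 nat"
  proof -
    have *: "Poly_Mapping.lookup v i \<le> Poly_Mapping.lookup u i" for i
      using that[symmetric] by (simp add: lookup_add)
    show ?thesis
      by (auto simp: in_keys_iff intro: order_trans[OF *] Max_ge) (metis * le_zero_eq)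
  qed
  have inj: "inj_on Poly_Mapping.lookup A" for A :: "(nat \<Rightarrow>\<^sub>0 nat) set"
    by (auto simp: inj_on_def poly_mapping_eqI)
  have fv: "finite {v. \<exists>w. v + w = u}"
    by (rule finite_imageD[OF finite_subset[OF _ fB] inj]) (use le in auto)
  have "{(v, w). v + w = u} \<subseteq> {v. \<exists>w. v + w = u} \<times> {v. \<exists>w. v + w = u}"
    by auto (metis add.commute)
  then show ?thesis using fv finite_subset by blast
qed

lemma mps_mult_commute: "mps_mult F G = mps_mult G F"
  unfolding mps_mult_def
  by (rule ext, rule sum.reindex_bij_witness[of _ "\<lambda>(v,w). (w,v)" "\<lambda>(v,w). (w,v)"])
     (auto simp: ac_simps)

lemma mps_mult_assoc: "mps_mult (mps_mult F G) H = mps_mult F (mps_mult G H)"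
proof
  fix u
  have "mps_mult (mps_mult F G) H u =
     (\<Sum>x\<in>{(v,w). v+w=u}. \<Sum>y\<in>{(a,b). a+b=fst x}. F (fst y) * G (snd y) * H (snd x))"
    unfolding mps_mult_def by (simp add: case_prod_unfold sum_distrib_right)
  also have "\<dots> = (\<Sum>(x,y)\<in>(SIGMA x:{(v,w). v+w=u}. {(a,b). a+b=fst x}). F (fst y) * G (snd y) * H (snd x))"
    by (rule sum.Sigma) (auto simp: finite_splits)
  also have "\<dots> = (\<Sum>(x,y)\<in>(SIGMA x:{(v,w). v+w=u}. {(a,b). a+b=snd x}). F (fst x) * (G (fst y) * H (snd y)))"
    by (rule sum.reindex_bij_witness[of _ "\<lambda>((a,p),(b,c)). ((a+b,c),(a,b))" "\<lambda>((p,c),(a,b)). ((a,b + c),(b,c))"])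
       (auto simp: ac_simps)
  also have "\<dots> = (\<Sum>x\<in>{(v,w). v+w=u}. \<Sum>y\<in>{(a,b). a+b=snd x}. F (fst x) * (G (fst y) * H (snd y)))"
    by (rule sum.Sigma[symmetric]) (auto simp: finite_splits)
  also have "\<dots> = mps_mult F (mps_mult G H) u"
    unfolding mps_mult_def by (simp add: case_prod_unfold sum_distrib_left)
  finally show "mps_mult (mps_mult F G) H u = mps_mult F (mps_mult G H) u" .
qed

lemma mps_mult_const: "mps_mult (mps_const c) F u = c * F u"
proof -
  have "mps_mult (mps_const c) F u = (\<Sum>(v,w)\<in>{(0,u)}. mps_const c v * F w)"
    unfolding mps_mult_def
    by (rule sum.mono_neutral_right) (auto simp: finite_splits mps_const_def split: if_splits)
  then show ?thesis by (simp add: mps_const_def)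
qed

lemma mps_distrib: "mps_mult (\<lambda>u. F u + G u) H = (\<lambda>u. mps_mult F H u + mps_mult G H u)"
  unfolding mps_mult_def by (auto simp: case_prod_unfold algebra_simps sum.distrib)

lemma mps_closed: assumes "F \<in> carrier (mps_ring n)" "G \<in> carrier (mps_ring n)"
  shows "mps_mult F G \<in> carrier (mps_ring n)"
proof -
  have "Poly_Mapping.keys u \<subseteq> {..<n}" if nz: "mps_mult F G u \<noteq> 0" for u
  proof -
    obtain v w where "v + w = u" "F v * G w \<noteq> 0"
      using nz sum.neutral[of "{(v, w). v + w = u}" "\<lambda>(v, w). F v * G w"]
      unfolding mps_mult_def by fastforce
    then have "F v \<noteq> 0" "G w \<noteq> 0"
      by auto
    then have "Poly_Mapping.keys v \<subseteq> {..<n}" "Poly_Mapping.keys w \<subseteq> {..<n}"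
      using assms by (simp_all add: mps_ring_def)
    then show ?thesis using \<open>v + w = u\<close> Poly_Mapping.keys_add[of v w] by blast
  qed
  then show ?thesis by (auto simp: mps_ring_def)
qed

lemma cring_mps_ring: "cring (mps_ring n :: 'k::comm_ring_1 mps ring)"
proof (rule cringI)
  show "abelian_group (mps_ring n :: 'k::comm_ring_1 mps ring)"
  proof (rule abelian_groupI)
    fix F :: "'k mps" assume "F \<in> carrier (mps_ring n)"
    then show "\<exists>G\<in>carrier (mps_ring n). G \<oplus>\<^bsub>mps_ring n\<^esub> F = \<zero>\<^bsub>mps_ring n\<^esub>"
      by (intro bexI[of _ "\<lambda>u. - F u"]) (auto simp: mps_ring_def)
  qed (auto simp: mps_ring_def ac_simps, force)
next
  show "comm_monoid (mps_ring n :: 'k::comm_ring_1 mps ring)"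
  proof (rule comm_monoidI)
    show "\<one>\<^bsub>mps_ring n\<^esub> \<in> carrier (mps_ring n :: 'k::comm_ring_1 mps ring)"
      by (auto simp: mps_ring_def mps_const_def)
    show "x \<otimes>\<^bsub>mps_ring n\<^esub> y \<in> carrier (mps_ring n)" if "x \<in> carrier (mps_ring n)" "y \<in> carrier (mps_ring n)"
      for x y :: "'k mps"
      using mps_closed[OF that] by (simp add: mps_ring_def)
    show "\<one>\<^bsub>mps_ring n\<^esub> \<otimes>\<^bsub>mps_ring n\<^esub> x = x" for x :: "'k mps"
      by (simp add: mps_ring_def mps_mult_const fun_eq_iff)
    show "x \<otimes>\<^bsub>mps_ring n\<^esub> y = y \<otimes>\<^bsub>mps_ring n\<^esub> x" for x y :: "'k mps"
      by (simp add: mps_ring_def mps_mult_commute)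
  qed (simp add: mps_ring_def mps_mult_assoc)
qed (auto simp: mps_ring_def mps_distrib)

definition mps_deriv :: "nat \<Rightarrow> 'k::comm_ring_1 mps \<Rightarrow> 'k mps" where
  "mps_deriv i F =
    (\<lambda>u. of_nat (Poly_Mapping.lookup u i + 1) * F (u + Poly_Mapping.single i 1))"

text \<open>The value \<open>F(x\<^sub>0, \<dots>, x\<^bsub>n-1\<^esub>)\<close>, regarded as an element of \<open>k((t))\<close>. It is meant for
  \<open>F \<in> carrier (mps_ring n)\<close> and power series \<open>x\<^sub>i\<close> without constant term; then only finitely
  many exponent vectors contribute to each coefficient, so that \<open>Sum_any\<close> is a genuine sum.\<close>

definition mps_eval :: "(nat \<Rightarrow> 'k::field fps) \<Rightarrow> 'k mps \<Rightarrow> 'k fls" where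
  "mps_eval x F = fps_to_fls (Abs_fps (\<lambda>d.
     Sum_any (\<lambda>u. F u * fps_nth (\<Prod>i\<in>Poly_Mapping.keys u. x i ^ Poly_Mapping.lookup u i) d)))"

section \<open>Subrings of \<open>k((t))\<close>\<close>

definition fls_ring :: "'k::field fls ring" where
  "fls_ring = ring_of_type_algebra"

definition fls_subring :: "'k::field fls set \<Rightarrow> 'k fls ring" where
  "fls_subring A = fls_ring \<lparr> carrier := A \<rparr>"

definition power_series_subring :: "nat \<Rightarrow> (nat \<Rightarrow> 'k::field fps) \<Rightarrow> 'k fls set" where
  "power_series_subring n x = mps_eval x ` carrier (mps_ring n)"

definition fraction_field :: "'k::field fls set \<Rightarrow> 'k fls set" where
  "fraction_field A = {f / g | f g. f \<in> A \<and> g \<in> A \<and> g \<noteq> 0}"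

definition integral_closure :: "'k::field fls set \<Rightarrow> 'k fls set" where
  "integral_closure A = {q \<in> fraction_field A.
     \<exists>p. lead_coeff p = 1 \<and> (\<forall>i. poly.coeff p i \<in> A) \<and> poly p q = 0}"

definition conductor :: "'k::field fls set \<Rightarrow> 'k fls set" where
  "conductor A = {q \<in> fraction_field A. \<forall>b \<in> integral_closure A. q * b \<in> A}"

section \<open>Local rings\<close>

text \<open>The maximal ideal of a local ring is its set of non-units.\<close>

definition max_ideal :: "('a, 'b) ring_scheme \<Rightarrow> 'a set" where
  "max_ideal A = carrier A - Units A"

definition embedding_dim :: "('a, 'b) ring_scheme \<Rightarrow> nat" where
  "embedding_dim A =
     (LEAST d. \<exists>G. finite G \<and> card G = d \<and> G \<subseteq> carrier A \<and> genideal A G = max_ideal A)"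

definition minimal_generators ::
  "('a, 'b) ring_scheme \<Rightarrow> 'a set \<Rightarrow> nat \<Rightarrow> (nat \<Rightarrow> 'a) \<Rightarrow> bool" where
  "minimal_generators A I n g \<longleftrightarrow>
     g ` {..<n} \<subseteq> carrier A \<and> genideal A (g ` {..<n}) = I \<and>
     (\<forall>K. K \<subset> {..<n} \<longrightarrow> genideal A (g ` K) \<noteq> I)"

section \<open>Quasi-homogeneous algebras\<close>

definition weighted_homogeneous_poly :: "nat \<Rightarrow> (nat \<Rightarrow> nat) \<Rightarrow> 'k::comm_ring_1 mps \<Rightarrow> bool" where
  "weighted_homogeneous_poly m w F \<longleftrightarrow>
     F \<in> carrier (mps_ring m) \<and> finite {u. F u \<noteq> 0} \<and>
     (\<exists>d. \<forall>u. F u \<noteq> 0 \<longrightarrow> (\<Sum>i<m. w i * Poly_Mapping.lookup u i) = d)"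

text \<open>Here \<open>\<iota>\<close> is the structure map of the \<open>k\<close>-algebra \<open>A\<close>; the isomorphism is one of
  \<open>k\<close>-algebras.\<close>

definition quasi_homogeneous :: "('k::field \<Rightarrow> 'a) \<Rightarrow> ('a, 'b) ring_scheme \<Rightarrow> bool" where
  "quasi_homogeneous \<iota> A \<longleftrightarrow>
     (\<exists>m w (P :: 'k mps set) J h.
        (\<forall>i<m. 0 < w i) \<and>
        (\<forall>F\<in>P. weighted_homogeneous_poly m w F) \<and>
        J = genideal (mps_ring m) P \<and>
        h \<in> ring_iso (mps_ring m Quot J) A \<and>
        (\<forall>c. h (J +>\<^bsub>mps_ring m\<^esub> mps_const c) = \<iota> c))"

section \<open>Modules and differentials\<close>

definition quotient_module :: "('a, 'b, 'c) module_scheme \<Rightarrow> 'b set \<Rightarrow> ('a, 'b set) module" where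
  "quotient_module M N =
    \<lparr> carrier = a_rcosets\<^bsub>M\<^esub> N,
      monoid.mult = undefined,
      one = undefined,
      ring.zero = N,
      ring.add = set_add M,
      module.smult = (\<lambda>r U. \<Union>u\<in>U. N +>\<^bsub>M\<^esub> (r \<odot>\<^bsub>M\<^esub> u)) \<rparr>"

definition torsion_submodule ::
  "('a, 'r) ring_scheme \<Rightarrow> ('a, 'b, 'c) module_scheme \<Rightarrow> 'b set" where
  "torsion_submodule A M =
     {v \<in> carrier M. \<exists>r \<in> carrier A. r \<noteq> \<zero>\<^bsub>A\<^esub> \<and> r \<odot>\<^bsub>M\<^esub> v = \<zero>\<^bsub>M\<^esub>}"

definition free_module :: "'k::field fls set \<Rightarrow> nat \<Rightarrow> ('k fls, 'k fls vec) module" where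
  "free_module A n =
     (module_vec TYPE('k fls) n)
       \<lparr> carrier := {v \<in> carrier_vec n. \<forall>i<n. vec_index v i \<in> A} \<rparr>"

definition jacobian_matrix ::
  "nat \<Rightarrow> nat \<Rightarrow> (nat \<Rightarrow> 'k::field fps) \<Rightarrow> (nat \<Rightarrow> 'k mps) \<Rightarrow> 'k fls mat" where
  "jacobian_matrix n m x f = mat n m (\<lambda>(i, j). mps_eval x (mps_deriv i (f j)))"

text \<open>The module of differentials of \<open>A = k[[X\<^sub>0, \<dots>, X\<^bsub>n-1\<^esub>]]/(f\<^sub>0, \<dots>, f\<^bsub>m-1\<^esub>)\<close>,
  \<open>X\<^sub>i \<mapsto> x\<^sub>i\<close>: the cokernel of the Jacobian matrix acting on column vectors.\<close>

definition differentials ::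
  "nat \<Rightarrow> nat \<Rightarrow> (nat \<Rightarrow> 'k::field fps) \<Rightarrow> (nat \<Rightarrow> 'k mps) \<Rightarrow> ('k fls, 'k fls vec set) module" where
  "differentials n m x f =
     (let A = power_series_subring n x in
      quotient_module (free_module A n)
        (mult_mat_vec (jacobian_matrix n m x f) ` carrier (free_module A m)))"

end

theory Submission
  imports Defs "HOL-Library.Function_Algebras"
begin

text \<open>A derivation \<open>D\<close> of a subring of \<open>k[[t]]\<close> with nonzero conductor, with values in \<open>k((t))\<close>, is
  \<open>\<epsilon> d/dt\<close> for some \<open>\<epsilon> \<in> k((t))\<close>. Applied to the Euler derivation of the quasi-homogeneous ring
  \<open>S = R + \<CC>/x\<^sub>1\<close>, this shows that modulo \<open>\<CC>/x\<^sub>1\<close> every element of the maximal ideal of \<open>R\<close> is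
  a sum of elements of \<open>R\<close> that are eigenvectors of \<open>\<epsilon> d/dt\<close> with positive integral eigenvalues.

  If \<open>p\<close> and \<open>q\<close> are such elements, with eigenvalues \<open>d\<close> and \<open>e\<close>, then \<open>p q' - (e/d) q p'\<close> has so
  high an order that it is the derivative of an element of the conductor \<open>\<CC> \<subseteq> \<mm>\<^sup>2\<close>, the value of a
  power series \<open>G\<close> without linear part. So \<open>p dq - (e/d) q dp - dG\<close> is zero in \<open>k((t)) dt\<close>, that
  is, torsion in the module of differentials. If it is zero there, then, lifted to the power series
  ring, it is \<open>\<Sum> w\<^sub>j df\<^sub>j\<close> modulo \<open>I\<close>; since \<open>I\<close> has no linear terms, its exterior derivative
  vanishes at the origin. But that exterior derivative is \<open>(1 + e/d) dp \<and> dq\<close>, and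
  \<open>1 + e/d \<noteq> 0\<close>. Hence all linear parts of elements of \<open>\<mm>\<close> are proportional, which is absurd as
  \<open>R\<close> has embedding dimension at least two.\<close>

section \<open>Power series rings and partial derivatives\<close>

text \<open>The orders in \<open>t\<close> fit exactly. The conductor is \<open>t^c k[[t]]\<close>,
  and division by \<open>x_1\<close> costs the least exponent \<open>a\<close>, so the errors modulo
  \<open>R\<close> lie in \<open>t^(c-a) k[[t]]\<close>. If \<open>u\<close> has order at least
  \<open>c - a\<close> and \<open>v\<close> order at least \<open>a\<close>, then
  \<open>u v'\<close> and \<open>v u'\<close> have order at least \<open>c - 1\<close>, and
  integration brings them back into the conductor. Products of two errors obey the same bound
  because C contained in m^2 forces \<open>2a \<le> c\<close>. The factor \<open>e/d\<close> is the
  one for which the eigenvector parts cancel.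

  The obstacle is continuity. The isomorphism of \<open>S\<close> with a quotient of
  \<open>k[[Y]]\<close> is only algebraic, and a derivation from \<open>k[[t]]\<close> to
  \<open>k((t))\<close> need not be determined by its value at \<open>t\<close>. Two facts replace a
  topology: a power series with nonzero constant term is a unit, so an algebraic homomorphism into
  \<open>k[[t]]\<close> is local and respects orders; and the derivations that occur have values of
  bounded pole order, which forces the form \<open>\<epsilon> d/dt\<close>.\<close>

abbreviation PS :: "nat \<Rightarrow> 'k::comm_ring_1 mps set" where
  "PS n \<equiv> carrier (mps_ring n)"

abbreviation unit_exp :: "nat \<Rightarrow> nat \<Rightarrow>\<^sub>0 nat" where
  "unit_exp i \<equiv> Poly_Mapping.single i 1"

lemma PS_iff: "F \<in> PS n \<longleftrightarrow> (\<forall>u. F u \<noteq> 0 \<longrightarrow> Poly_Mapping.keys u \<subseteq> {..<n})"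
  by (simp add: mps_ring_def)

lemma mps_ring_simps:
  "monoid.mult (mps_ring n) = mps_mult" "one (mps_ring n) = mps_const 1"
  "ring.zero (mps_ring n) = 0" "ring.add (mps_ring n) = (+)"
  by (simp_all add: mps_ring_def fun_eq_iff)

lemma PS_const: "mps_const c \<in> PS n"
  by (auto simp: PS_iff mps_const_def)

lemma PS_var: "i < n \<Longrightarrow> mps_var i \<in> PS n"
  by (auto simp: PS_iff mps_var_def)

lemma PS_0: "0 \<in> PS n"
  by (auto simp: PS_iff)

lemma PS_add: "F \<in> PS n \<Longrightarrow> G \<in> PS n \<Longrightarrow> F + G \<in> PS n"
  by (auto simp: PS_iff) (metis add.right_neutral subsetD lessThan_iff)

lemma PS_uminus: "F \<in> PS n \<Longrightarrow> - F \<in> PS n"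
  by (auto simp: PS_iff)

lemma PS_diff: "F \<in> PS n \<Longrightarrow> G \<in> PS n \<Longrightarrow> F - G \<in> PS n"
  using PS_add[of F n "-G"] PS_uminus[of G n] by simp

lemma PS_sum: "(\<And>i. i \<in> A \<Longrightarrow> F i \<in> PS n) \<Longrightarrow> (\<Sum>i\<in>A. F i) \<in> PS n"
  by (induction A rule: infinite_finite_induct) (auto simp: PS_0 PS_add)

lemma PS_mult: "F \<in> PS n \<Longrightarrow> G \<in> PS n \<Longrightarrow> mps_mult F G \<in> PS n"
  by (rule mps_closed)

lemma PS_deriv: assumes "F \<in> PS n" shows "mps_deriv i F \<in> PS n"
  unfolding PS_iff
proof (intro allI impI)
  fix u assume "mps_deriv i F u \<noteq> 0"
  then have "F (u + unit_exp i) \<noteq> 0" by (auto simp: mps_deriv_def)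
  then have "Poly_Mapping.keys (u + unit_exp i) \<subseteq> {..<n}"
    using assms unfolding PS_iff by blast
  moreover have "Poly_Mapping.keys u \<subseteq> Poly_Mapping.keys (u + unit_exp i)"
    by (auto simp: in_keys_iff lookup_add)
  ultimately show "Poly_Mapping.keys u \<subseteq> {..<n}" by blast
qed

lemmas PS_intros = PS_const PS_var PS_0 PS_add PS_uminus PS_diff PS_sum PS_mult PS_deriv

lemma mps_mult_add_left: "mps_mult (F + G) H = mps_mult F H + mps_mult G H"
  unfolding plus_fun_def by (rule mps_distrib)

lemma mps_mult_add_right: "mps_mult H (F + G) = mps_mult H F + mps_mult H G"
  by (metis mps_mult_add_left mps_mult_commute)

lemma mps_mult_0_left: "mps_mult 0 H = 0"
  by (auto simp: mps_mult_def fun_eq_iff)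

lemma mps_mult_uminus_left: "mps_mult (- F) H = - mps_mult F H"
  by (auto simp: mps_mult_def fun_eq_iff sum_negf case_prod_unfold)

lemma mps_mult_diff_left: "mps_mult (F - G) H = mps_mult F H - mps_mult G H"
  using mps_mult_add_left[of F "- G" H] by (simp add: mps_mult_uminus_left)

lemma sum_fun_apply: "(\<Sum>i\<in>A. f i) u = (\<Sum>i\<in>A. f i u)"
  by (induction A rule: infinite_finite_induct) auto

lemma mps_mult_one: "mps_mult (mps_const 1) F = F"
  by (simp add: fun_eq_iff mps_mult_const)

lemma exp_sum_zero: "{(v, w). v + w = (0::nat \<Rightarrow>\<^sub>0 nat)} = {(0, 0)}"
proof -
  have "v = 0" if "v + w = 0" for v w :: "nat \<Rightarrow>\<^sub>0 nat"
    by (rule poly_mapping_eqI) (metis that add_eq_0_iff_both_eq_0 lookup_add lookup_zero)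
  then show ?thesis by (auto, (metis add.commute)+)
qed

lemma mps_mult_nth_0: "mps_mult F G 0 = F 0 * G 0"
  by (simp add: mps_mult_def exp_sum_zero)

text \<open>Subtraction of exponent vectors is truncated, hence the separate case in which
  \<open>X_i\<close> does not divide the monomial.\<close>

lemma mps_mult_var:
  "mps_mult (mps_var i) F u = (if Poly_Mapping.lookup u i = 0 then 0 else F (u - unit_exp i))"
proof (cases "Poly_Mapping.lookup u i = 0")
  case True
  have "mps_mult (mps_var i) F u = 0"
    unfolding mps_mult_def
  proof (rule sum.neutral, clarify)
    fix v w assume "u = v + w"
    then have "v \<noteq> unit_exp i" using True by (auto simp: lookup_add)
    then show "mps_var i v * F w = 0" by (simp add: mps_var_def)
  qed
  then show ?thesis using True by simp
next
  case False
  have u: "unit_exp i + (u - unit_exp i) = u"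
    by (rule poly_mapping_eqI) (use False in \<open>auto simp: lookup_add lookup_minus lookup_single when_def\<close>)
  have "mps_mult (mps_var i) F u = (\<Sum>(v, w)\<in>{(unit_exp i, u - unit_exp i)}. mps_var i v * F w)"
    unfolding mps_mult_def
    by (rule sum.mono_neutral_right) (use u in \<open>auto simp: finite_splits mps_var_def split: if_splits\<close>)
  then show ?thesis using False by (simp add: mps_var_def)
qed

lemma mps_deriv_add: "mps_deriv i (F + G) = mps_deriv i F + mps_deriv i G"
  by (simp add: mps_deriv_def fun_eq_iff algebra_simps)

lemma mps_deriv_0: "mps_deriv i 0 = 0"
  by (simp add: mps_deriv_def fun_eq_iff)

lemma add_unit_exp_neq_0: "u + unit_exp i \<noteq> 0"
  by (metis add_eq_0_iff_both_eq_0 lookup_add lookup_single_eq lookup_zero one_neq_zero)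

lemma mps_deriv_const: "mps_deriv i (mps_const c) = 0"
  using add_unit_exp_neq_0[of _ i] by (simp add: mps_deriv_def mps_const_def fun_eq_iff)

lemma mps_deriv_var: "mps_deriv i (mps_var j) = mps_const (if i = j then 1 else 0)"
proof -
  have "u + unit_exp i = unit_exp j \<longleftrightarrow> u = 0 \<and> i = j" for u
  proof
    assume h: "u + unit_exp i = unit_exp j"
    have "Poly_Mapping.lookup u i + 1 = Poly_Mapping.lookup (unit_exp j) i"
      unfolding h[symmetric] by (simp add: lookup_add)
    then have "i = j" by (auto simp: lookup_single when_def split: if_splits)
    then show "u = 0 \<and> i = j" using h by simp
  qed auto
  then show ?thesis
    by (auto simp: mps_deriv_def mps_var_def mps_const_def fun_eq_iff)
qed

text \<open>One half of the product rule: over all splittings \<open>v + w\<close> of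
  \<open>u + unit_exp i\<close> the factor \<open>u_i + 1\<close> is \<open>v_i + w_i\<close>.
  Splittings with \<open>v_i = 0\<close> drop out and the others are shifted back by
  \<open>unit_exp i\<close>.\<close>

lemma mps_mult_shift:
  "(\<Sum>(v, w)\<in>{(v, w). v + w = u + unit_exp i}. of_nat (Poly_Mapping.lookup v i) * (F v * G w)) =
    mps_mult (mps_deriv i F) G u"
proof -
  let ?e = "unit_exp i"
  let ?f = "\<lambda>(v, w). of_nat (Poly_Mapping.lookup v i) * (F v * G w)"
  have "sum ?f {(v, w). v + w = u + ?e} = sum ?f {(v, w). v + w = u + ?e \<and> Poly_Mapping.lookup v i \<noteq> 0}"
    by (rule sum.mono_neutral_right) (auto simp: finite_splits intro!: Nat.gr0I)
  also have "\<dots> = mps_mult (mps_deriv i F) G u"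
    unfolding mps_mult_def
  proof (rule sum.reindex_bij_witness[of _ "\<lambda>(v, w). (v + ?e, w)" "\<lambda>(v, w). (v - ?e, w)"], goal_cases)
    case (1 p)
    then show ?case
      by (auto intro!: poly_mapping_eqI simp: lookup_add lookup_minus lookup_single when_def)
  next
    case (2 p)
    obtain v w where p: "p = (v, w)" by fastforce
    have vw: "v + w = u + ?e" and nz: "Poly_Mapping.lookup v i \<noteq> 0" using 2 p by auto
    have v: "v - ?e + ?e = v"
      by (rule poly_mapping_eqI) (use nz in \<open>auto simp: lookup_add lookup_minus lookup_single when_def\<close>)
    have "v - ?e + w + ?e = u + ?e" by (metis v vw add.assoc add.commute)
    then show ?case using p by simp
  next
    case (3 p)
    then show ?case by (auto simp: ac_simps)
  next
    case (4 p)
    then show ?case by (auto simp: ac_simps lookup_add)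
  next
    case (5 p)
    obtain v w where p: "p = (v, w)" by fastforce
    have nz: "Poly_Mapping.lookup v i \<noteq> 0" using 5 p by auto
    have v: "v - ?e + ?e = v"
      by (rule poly_mapping_eqI) (use nz in \<open>auto simp: lookup_add lookup_minus lookup_single when_def\<close>)
    have "Poly_Mapping.lookup (v - ?e) i + 1 = Poly_Mapping.lookup v i"
      using nz by (simp add: lookup_minus)
    then show ?case using v by (simp add: p mps_deriv_def del: of_nat_Suc of_nat_add flip: mult.assoc)
  qed
  finally show ?thesis .
qed

lemma mps_deriv_mult:
  "mps_deriv i (mps_mult F G) = mps_mult (mps_deriv i F) G + mps_mult F (mps_deriv i G)"
proof
  fix u
  let ?P = "{(v, w). v + w = u + unit_exp i}"
  have "mps_deriv i (mps_mult F G) u =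
      (\<Sum>(v, w)\<in>?P. of_nat (Poly_Mapping.lookup u i + 1) * (F v * G w))"
    by (simp add: mps_deriv_def mps_mult_def sum_distrib_left case_prod_unfold)
  also have "\<dots> = (\<Sum>(v, w)\<in>?P. of_nat (Poly_Mapping.lookup v i) * (F v * G w)
      + of_nat (Poly_Mapping.lookup w i) * (G w * F v))"
  proof (rule sum.cong[OF refl], clarify)
    fix v w assume "v + w = u + unit_exp i"
    then have "Poly_Mapping.lookup u i + 1 = Poly_Mapping.lookup v i + Poly_Mapping.lookup w i"
      by (metis lookup_add lookup_single_eq)
    then show "of_nat (Poly_Mapping.lookup u i + 1) * (F v * G w) =
        of_nat (Poly_Mapping.lookup v i) * (F v * G w) + of_nat (Poly_Mapping.lookup w i) * (G w * F v)"
      by (simp only: of_nat_add distrib_right mult.commute[of "G w"])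
  qed
  also have "\<dots> = (\<Sum>(v, w)\<in>?P. of_nat (Poly_Mapping.lookup v i) * (F v * G w)) +
      (\<Sum>(v, w)\<in>?P. of_nat (Poly_Mapping.lookup w i) * (G w * F v))"
    by (simp add: sum.distrib case_prod_unfold)
  also have "(\<Sum>(v, w)\<in>?P. of_nat (Poly_Mapping.lookup w i) * (G w * F v)) =
      (\<Sum>(v, w)\<in>?P. of_nat (Poly_Mapping.lookup v i) * (G v * F w))"
    by (rule sum.reindex_bij_witness[of _ "\<lambda>(v, w). (w, v)" "\<lambda>(v, w). (w, v)"]) (auto simp: ac_simps)
  also have "\<dots> = mps_mult F (mps_deriv i G) u"
    by (simp only: mps_mult_shift mps_mult_commute[of F])
  also have "(\<Sum>(v, w)\<in>?P. of_nat (Poly_Mapping.lookup v i) * (F v * G w)) = mps_mult (mps_deriv i F) G u"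
    by (rule mps_mult_shift)
  finally show "mps_deriv i (mps_mult F G) u = (mps_mult (mps_deriv i F) G + mps_mult F (mps_deriv i G)) u"
    by simp
qed

text \<open>An entry of the Hessian at the origin. Its symmetry in \<open>i\<close> and
  \<open>l\<close> is what makes exterior derivatives of exact forms vanish there.\<close>

lemma mps_deriv_unit_exp: "mps_deriv i F (unit_exp l) = of_nat (if i = l then 2 else 1) * F (unit_exp i + unit_exp l)"
  by (auto simp: mps_deriv_def lookup_single when_def add.commute)

lemma mps_deriv_0_nth: "mps_deriv i F 0 = F (unit_exp i)"
  by (simp add: mps_deriv_def)

lemma mps_mult_nth_unit: 
  "mps_mult F G (unit_exp l) = F 0 * G (unit_exp l) + F (unit_exp l) * G 0"
proof -
  have "mps_deriv l (mps_mult F G) 0 = (mps_mult (mps_deriv l F) G + mps_mult F (mps_deriv l G)) 0"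
    by (simp add: mps_deriv_mult)
  then show ?thesis by (simp add: mps_deriv_0_nth mps_mult_nth_0)
qed

section \<open>Weights and degrees of exponents; inverses of power series\<close>

definition exp_weight :: "nat \<Rightarrow> (nat \<Rightarrow> nat) \<Rightarrow> (nat \<Rightarrow>\<^sub>0 nat) \<Rightarrow> nat" where
  "exp_weight m w u = (\<Sum>i<m. w i * Poly_Mapping.lookup u i)"

abbreviation exp_deg :: "nat \<Rightarrow> (nat \<Rightarrow>\<^sub>0 nat) \<Rightarrow> nat" where
  "exp_deg m \<equiv> exp_weight m (\<lambda>_. 1)"

lemma exp_weight_add: "exp_weight m w (u + v) = exp_weight m w u + exp_weight m w v"
  by (simp add: exp_weight_def lookup_add algebra_simps sum.distrib)

lemma exp_weight_0: "exp_weight m w 0 = 0"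
  by (simp add: exp_weight_def)

lemma exp_deg_unit: "i < m \<Longrightarrow> exp_deg m (unit_exp i) = 1"
  by (simp add: exp_weight_def lookup_single when_def)

lemma exp_deg_eq_0: "Poly_Mapping.keys u \<subseteq> {..<m} \<Longrightarrow> exp_deg m u = 0 \<Longrightarrow> u = 0"
  by (rule poly_mapping_eqI) (auto simp: exp_weight_def in_keys_iff subset_iff)

text \<open>The quotient \<open>G i\<close> collects the monomials whose first occurring variable is \<open>X\<^sub>i\<close>.\<close>

lemma mps_decomp:
  fixes F :: "'k::comm_ring_1 mps"
  assumes F: "F \<in> PS m"
  shows "\<exists>G. (\<forall>i<m. G i \<in> PS m) \<and>
    F = mps_const (F 0) + (\<Sum>i<m. mps_mult (mps_var i) (G i)) \<and>
    (\<forall>i u. G i u \<noteq> 0 \<longrightarrow> F (u + unit_exp i) \<noteq> 0)"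
proof -
  define G where "G = (\<lambda>i u. if Poly_Mapping.keys u \<subseteq> {i..} then F (u + unit_exp i) else 0)"
  have nz: "F (u + unit_exp i) \<noteq> 0" if "G i u \<noteq> 0" for i u
    using that by (auto simp: G_def split: if_splits)
  have GPS: "G i \<in> PS m" if "i < m" for i
    unfolding PS_iff
  proof (intro allI impI)
    fix u assume "G i u \<noteq> 0"
    then have "Poly_Mapping.keys (u + unit_exp i) \<subseteq> {..<m}"
      using nz F unfolding PS_iff by blast
    moreover have "Poly_Mapping.keys u \<subseteq> Poly_Mapping.keys (u + unit_exp i)"
      by (auto simp: in_keys_iff lookup_add)
    ultimately show "Poly_Mapping.keys u \<subseteq> {..<m}" by blast
  qed
  have "F = mps_const (F 0) + (\<Sum>i<m. mps_mult (mps_var i) (G i))"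
  proof
    fix u
    show "F u = (mps_const (F 0) + (\<Sum>i<m. mps_mult (mps_var i) (G i))) u"
    proof (cases "u = 0")
      case True
      then show ?thesis by (simp add: sum_fun_apply mps_mult_var mps_const_def)
    next
      case False
      then have ne: "Poly_Mapping.keys u \<noteq> {}" by simp
      define i0 where "i0 = Min (Poly_Mapping.keys u)"
      have i0: "i0 \<in> Poly_Mapping.keys u" "\<And>j. j \<in> Poly_Mapping.keys u \<Longrightarrow> i0 \<le> j"
        using ne by (auto simp: i0_def)
      have i0': "Poly_Mapping.lookup u i0 \<noteq> 0" using i0 by (simp add: in_keys_iff)
      have v: "u - unit_exp i0 + unit_exp i0 = u"
        by (rule poly_mapping_eqI) (use i0' in \<open>auto simp: lookup_add lookup_minus lookup_single when_def\<close>)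
      have "Poly_Mapping.keys (u - unit_exp i0) \<subseteq> Poly_Mapping.keys u"
        by (auto simp: in_keys_iff lookup_minus)
      then have "Poly_Mapping.keys (u - unit_exp i0) \<subseteq> {i0..}" using i0 by auto
      then have main: "mps_mult (mps_var i0) (G i0) u = F u"
        using i0' v by (simp add: mps_mult_var G_def)
      have other: "mps_mult (mps_var i) (G i) u = 0" if "i \<noteq> i0" for i
      proof (cases "Poly_Mapping.lookup u i = 0")
        case False
        then have "i0 < i" using i0(2)[of i] that by (simp add: in_keys_iff)
        moreover have "i0 \<in> Poly_Mapping.keys (u - unit_exp i)"
          using i0' that by (simp add: in_keys_iff lookup_minus lookup_single when_def)
        ultimately have "\<not> Poly_Mapping.keys (u - unit_exp i) \<subseteq> {i..}" by auto
        then show ?thesis by (simp add: mps_mult_var G_def)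
      qed (simp add: mps_mult_var)
      have "(\<Sum>i<m. mps_mult (mps_var i) (G i) u) = (\<Sum>i<m. if i = i0 then F u else 0)"
        by (rule sum.cong) (auto simp: main other)
      also have "\<dots> = F u"
        using i0(1) F unfolding PS_iff by (cases "F u = 0") auto
      finally show ?thesis using False by (simp add: sum_fun_apply mps_const_def)
    qed
  qed
  then show ?thesis using nz GPS by blast
qed

text \<open>Geometric series: write \<open>F = F(0) (1 - H)\<close> with \<open>H\<close> free of
  constant term. Then \<open>H^k\<close> has only terms of degree at least \<open>k\<close>, so each
  coefficient of the sum of all \<open>H^k\<close> is a finite sum, and telescoping can be checked
  one coefficient at a time.\<close>

lemma mps_inverse:
  fixes F :: "'k::field mps"
  assumes F: "F \<in> PS m" and F0: "F 0 \<noteq> 0"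
  obtains G where "G \<in> PS m" "mps_mult F G = mps_const 1"
proof -
  define c where "c = inverse (F 0)"
  define H where "H = mps_const 1 - mps_mult (mps_const c) F"
  have H: "H \<in> PS m" unfolding H_def by (intro PS_intros F)
  have H0: "H 0 = 0" using F0 unfolding H_def minus_apply mps_mult_const by (simp add: mps_const_def c_def)
  \<comment> \<open>Powers are spelled out by recursion since the product is
    \<open>mps_mult\<close>, not pointwise multiplication of functions.\<close>
  define Pw where "Pw = rec_nat (mps_const 1) (\<lambda>_ P. mps_mult H P)"
  have Pw0: "Pw 0 = mps_const 1" and PwS: "Pw (Suc k) = mps_mult H (Pw k)" for k
    by (simp_all add: Pw_def)
  have PwPS: "Pw k \<in> PS m" for k
    by (induction k) (auto simp: Pw0 PwS intro!: PS_intros H)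
  have small: "Pw k u = 0" if "exp_deg m u < k" for k u
    using that
  proof (induction k arbitrary: u)
    case (Suc k)
    show ?case
      unfolding PwS mps_mult_def
    proof (rule sum.neutral, clarify)
      fix v w assume uvw: "u = v + w"
      show "H v * Pw k w = 0"
      proof (cases "H v = 0")
        case False
        then have "v \<noteq> 0" "Poly_Mapping.keys v \<subseteq> {..<m}" using H0 H by (auto simp: PS_iff)
        then have "exp_deg m v \<noteq> 0" using exp_deg_eq_0 by blast
        then have "exp_deg m w < k" using Suc.prems by (simp add: uvw exp_weight_add)
        then show ?thesis using Suc.IH by simp
      qed simp
    qed
  qed simp
  define G where "G = (\<lambda>u. \<Sum>k\<le>exp_deg m u. Pw k u)"
  have G: "G u = (\<Sum>k\<le>K. Pw k) u" if "exp_deg m u \<le> K" for u K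
    unfolding G_def sum_fun_apply
    by (rule sum.mono_neutral_left) (use that small in auto)
  have GPS: "G \<in> PS m"
    unfolding PS_iff
  proof (intro allI impI)
    fix u assume "G u \<noteq> 0"
    then obtain k where "Pw k u \<noteq> 0" unfolding G_def by (meson sum.neutral)
    then show "Poly_Mapping.keys u \<subseteq> {..<m}" using PwPS by (auto simp: PS_iff)
  qed
  have tele: "mps_mult (mps_const 1 - H) (\<Sum>k\<le>K. Pw k) = mps_const 1 - Pw (Suc K)" for K
    by (induction K)
       (simp_all add: mps_mult_add_right mps_mult_diff_left mps_mult_one PwS Pw0 del: plus_fun_apply minus_apply)
  have inv: "mps_mult (mps_const 1 - H) G = mps_const 1"
  proof
    fix u
    define K where "K = exp_deg m u"
    have "mps_mult (mps_const 1 - H) G u = mps_mult (mps_const 1 - H) (\<Sum>k\<le>K. Pw k) u"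
      unfolding mps_mult_def
    proof (rule sum.cong[OF refl], clarify)
      fix v w assume "u = v + w"
      then have "exp_deg m w \<le> K" by (simp add: K_def exp_weight_add)
      then show "(mps_const 1 - H) v * G w = (mps_const 1 - H) v * (\<Sum>k\<le>K. Pw k) w"
        using G by simp
    qed
    also have "\<dots> = mps_const 1 u - Pw (Suc K) u" by (simp add: tele)
    also have "Pw (Suc K) u = 0" by (rule small) (simp add: K_def)
    finally show "mps_mult (mps_const 1 - H) G u = mps_const 1 u" by (simp only: diff_0_right)
  qed
  show thesis
  proof
    show "mps_mult (mps_const c) G \<in> PS m" by (intro PS_intros GPS)
    have "mps_mult F (mps_mult (mps_const c) G) = mps_mult (mps_mult (mps_const c) F) G"
      by (metis mps_mult_assoc mps_mult_commute)
    also have "mps_mult (mps_const c) F = mps_const 1 - H" by (simp add: H_def)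
    finally show "mps_mult F (mps_mult (mps_const c) G) = mps_const 1" unfolding inv .
  qed
qed

section \<open>Evaluation and the chain rule\<close>

no_notation vec_index (infixl \<open>$\<close> 100)
unbundle fps_syntax

lemma fps_X_power_dvd_iff: "fps_X ^ k dvd (f :: 'k::field fps) \<longleftrightarrow> (\<forall>i<k. f $ i = 0)"
proof
  assume "fps_X ^ k dvd f"
  then show "\<forall>i<k. f $ i = 0" by (auto simp: fps_X_power_mult_nth elim!: dvdE)
next
  assume h: "\<forall>i<k. f $ i = 0"
  have "f = fps_X ^ k * fps_shift k f"
    by (rule fps_ext) (use h in \<open>simp add: fps_X_power_mult_nth\<close>)
  then show "fps_X ^ k dvd f" by (metis dvd_triv_left)
qed

text \<open>Krull's intersection theorem for \<open>k[[t]]\<close>; it takes the place of limit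
  arguments below.\<close>

lemma fps_eq_0_if_dvd_all:
  assumes "\<And>k. fps_X ^ k dvd (f :: 'k::field fps)"
  shows "f = 0"
proof (rule fps_ext)
  fix i show "f $ i = 0 $ i" using assms[of "Suc i"] unfolding fps_X_power_dvd_iff by simp
qed

definition exps :: "nat \<Rightarrow> nat \<Rightarrow> (nat \<Rightarrow>\<^sub>0 nat) set" where
  "exps n d = {u. Poly_Mapping.keys u \<subseteq> {..<n} \<and> exp_deg n u \<le> d}"

definition monom_eval :: "nat \<Rightarrow> (nat \<Rightarrow> 'k::field fps) \<Rightarrow> (nat \<Rightarrow>\<^sub>0 nat) \<Rightarrow> 'k fps" where
  "monom_eval n x u = (\<Prod>i<n. x i ^ Poly_Mapping.lookup u i)"

text \<open>\<open>mps_eval\<close> with values in \<open>k[[t]]\<close> and with an explicitly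
  finite sum. If the \<open>x i\<close> have no constant term, a monomial of degree above
  \<open>d\<close> cannot contribute to \<open>t^d\<close>, so nothing is lost.\<close>

definition ev :: "nat \<Rightarrow> (nat \<Rightarrow> 'k::field fps) \<Rightarrow> 'k mps \<Rightarrow> 'k fps" where
  "ev n x F = Abs_fps (\<lambda>d. \<Sum>u\<in>exps n d. F u * monom_eval n x u $ d)"

lemma exps_iff: "u \<in> exps n d \<longleftrightarrow> Poly_Mapping.keys u \<subseteq> {..<n} \<and> exp_deg n u \<le> d"
  by (simp add: exps_def)

lemma finite_exps: "finite (exps n d)"
proof -
  let ?B = "{f. \<forall>i. (i \<in> {..<n} \<longrightarrow> f i \<in> {..d}) \<and> (i \<notin> {..<n} \<longrightarrow> f i = (0::nat))}"
  have "Poly_Mapping.lookup u \<in> ?B" if "u \<in> exps n d" for u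
  proof -
    have "Poly_Mapping.lookup u i \<le> d" if i: "i < n" for i
    proof -
      have "Poly_Mapping.lookup u i \<le> exp_deg n u"
        unfolding exp_weight_def using i by (auto intro!: member_le_sum)
      then show ?thesis using \<open>u \<in> exps n d\<close> by (simp add: exps_iff)
    qed
    then show ?thesis using \<open>u \<in> exps n d\<close> by (auto simp: exps_iff in_keys_iff subset_iff)
  qed
  moreover have "finite ?B" by (rule finite_set_of_finite_funs) auto
  ultimately have "finite (Poly_Mapping.lookup ` exps n d)"
    by (meson finite_subset image_subsetI)
  then show ?thesis
    by (rule finite_imageD) (auto simp: inj_on_def poly_mapping_eqI)
qed

lemma exps_mono: "d \<le> e \<Longrightarrow> exps n d \<subseteq> exps n e"
  by (auto simp: exps_iff)

lemma keys_add_nat: "Poly_Mapping.keys (v + w) = Poly_Mapping.keys v \<union> Poly_Mapping.keys (w :: nat \<Rightarrow>\<^sub>0 nat)"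
  by (auto simp: in_keys_iff lookup_add)

lemma monom_eval_add: "monom_eval n x (u + v) = monom_eval n x u * monom_eval n x v"
  by (simp add: monom_eval_def lookup_add power_add prod.distrib)

lemma ev_add: "ev n x (F + G) = ev n x F + ev n x G"
  by (rule fps_ext) (simp add: ev_def algebra_simps sum.distrib)

lemma ev_0: "ev n x 0 = 0"
  by (rule fps_ext) (simp add: ev_def)

lemma ev_uminus: "ev n x (- F) = - ev n x F"
  by (rule fps_ext) (simp add: ev_def sum_negf)

lemma ev_diff: "ev n x (F - G) = ev n x F - ev n x G"
  by (rule fps_ext) (simp add: ev_def algebra_simps sum_subtractf)

lemma ev_sum: "ev n x (\<Sum>i\<in>A. F i) = (\<Sum>i\<in>A. ev n x (F i))"
  by (induction A rule: infinite_finite_induct)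
     (simp_all add: ev_0 ev_add del: zero_fun_apply plus_fun_apply)

lemma ev_const: "ev n x (mps_const c) = fps_const c"
proof (rule fps_ext)
  fix d
  have "ev n x (mps_const c) $ d = (\<Sum>u\<in>{0}. mps_const c u * monom_eval n x u $ d)"
    unfolding ev_def fps_nth_Abs_fps
    by (rule sum.mono_neutral_right) (auto simp: finite_exps exps_iff mps_const_def exp_weight_0)
  then show "ev n x (mps_const c) $ d = fps_const c $ d"
    by (simp add: mps_const_def monom_eval_def)
qed

locale fps_point =
  fixes n :: nat and x :: "nat \<Rightarrow> 'k::field fps"
  assumes x_nth_0: "i < n \<Longrightarrow> x i $ 0 = 0"
begin

lemma monom_eval_dvd: "fps_X ^ exp_deg n u dvd monom_eval n x u"
proof -
  have "fps_X dvd x i" if "i < n" for i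
    using x_nth_0[OF that] fps_X_power_dvd_iff[of 1 "x i"] by simp
  then have "(\<Prod>i<n. fps_X ^ Poly_Mapping.lookup u i) dvd (\<Prod>i<n. x i ^ Poly_Mapping.lookup u i)"
    by (intro prod_dvd_prod dvd_power_same) auto
  then show ?thesis by (simp add: monom_eval_def exp_weight_def power_sum)
qed

lemma monom_eval_nth: "d < exp_deg n u \<Longrightarrow> monom_eval n x u $ d = 0"
  using monom_eval_dvd[of u] by (simp add: fps_X_power_dvd_iff)

text \<open>The freedom to enlarge the index set: coefficients of different powers of
  \<open>t\<close> can be written as sums over one common set, as the product formula
  requires.\<close>

lemma ev_nth:
  assumes "d \<le> K"
  shows "ev n x F $ d = (\<Sum>u\<in>exps n K. F u * monom_eval n x u $ d)"
  unfolding ev_def fps_nth_Abs_fps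
  by (rule sum.mono_neutral_left)
     (use assms exps_mono[of d K n] in \<open>auto simp: finite_exps exps_iff intro!: monom_eval_nth\<close>)

lemma mps_eval_eq_ev:
  assumes "F \<in> PS n"
  shows "mps_eval x F = fps_to_fls (ev n x F)"
proof -
  have "(\<Prod>i\<in>Poly_Mapping.keys u. x i ^ Poly_Mapping.lookup u i) = monom_eval n x u"
    if "Poly_Mapping.keys u \<subseteq> {..<n}" for u
    unfolding monom_eval_def using that
    by (intro prod.mono_neutral_left) (auto simp: in_keys_iff)
  then have "F u * (\<Prod>i\<in>Poly_Mapping.keys u. x i ^ Poly_Mapping.lookup u i) $ d = F u * monom_eval n x u $ d" for u d
    using assms by (cases "F u = 0") (simp_all add: PS_iff)
  then have "Sum_any (\<lambda>u. F u * (\<Prod>i\<in>Poly_Mapping.keys u. x i ^ Poly_Mapping.lookup u i) $ d) =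
      Sum_any (\<lambda>u. F u * monom_eval n x u $ d)" for d by (simp only:)
  also have "Sum_any (\<lambda>u. F u * monom_eval n x u $ d) = ev n x F $ d" for d
    unfolding ev_def fps_nth_Abs_fps
  proof (rule Sum_any.expand_superset[OF finite_exps])
    show "{u. F u * monom_eval n x u $ d \<noteq> 0} \<subseteq> exps n d"
    proof clarify
      fix u assume "F u * monom_eval n x u $ d \<noteq> 0"
      then have "F u \<noteq> 0" "monom_eval n x u $ d \<noteq> 0" by auto
      then show "u \<in> exps n d"
        using assms monom_eval_nth[of d u] by (auto simp: exps_iff PS_iff simp flip: not_less simp del: One_nat_def)
    qed
  qed
  finally show ?thesis by (simp add: mps_eval_def fps_nth_inverse)
qed

lemma ev_var:
  assumes "i < n"
  shows "ev n x (mps_var i) = x i"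
proof (rule fps_ext)
  fix d
  have me: "monom_eval n x (unit_exp i) = x i"
  proof -
    have "monom_eval n x (unit_exp i) = (\<Prod>j<n. if j = i then x i else 1)"
      unfolding monom_eval_def by (rule prod.cong) (auto simp: lookup_single when_def)
    then show ?thesis using assms by simp
  qed
  \<comment> \<open>The bound \<open>Suc d\<close> ensures that \<open>unit_exp i\<close> belongs to
    the index set even for \<open>d = 0\<close>.\<close>
  have "ev n x (mps_var i) $ d = (\<Sum>u\<in>exps n (Suc d). mps_var i u * monom_eval n x u $ d)"
    by (rule ev_nth) simp
  also have "\<dots> = (\<Sum>u\<in>{unit_exp i}. mps_var i u * monom_eval n x u $ d)"
    by (rule sum.mono_neutral_right)
       (use assms exp_deg_unit[OF assms] in \<open>auto simp: finite_exps exps_iff mps_var_def split: if_splits\<close>)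
  finally show "ev n x (mps_var i) $ d = x i $ d" by (simp add: mps_var_def me del: One_nat_def)
qed

lemma ev_mult: "ev n x (mps_mult F G) = ev n x F * ev n x G"
proof (rule fps_ext)
  fix d
  let ?E = "exps n d" and ?m = "monom_eval n x"
  let ?S = "\<lambda>u. {(v, w). v + w = (u :: nat \<Rightarrow>\<^sub>0 nat)}"
  let ?t = "\<lambda>(v, w). F v * G w * ?m (v + w) $ d"
  have "ev n x (mps_mult F G) $ d = (\<Sum>u\<in>?E. \<Sum>p\<in>?S u. ?t p)"
    unfolding ev_def fps_nth_Abs_fps mps_mult_def sum_distrib_right
    by (intro sum.cong refl) auto
  also have "\<dots> = (\<Sum>(u, p)\<in>(SIGMA u:?E. ?S u). ?t p)"
    by (rule sum.Sigma) (auto simp: finite_exps finite_splits)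
  also have "\<dots> = (\<Sum>p\<in>{p \<in> ?E \<times> ?E. fst p + snd p \<in> ?E}. ?t p)"
    by (rule sum.reindex_bij_witness[of _ "\<lambda>(v, w). (v + w, (v, w))" "\<lambda>(u, p). p"])
       (auto simp: exps_iff exp_weight_add keys_add_nat)
  \<comment> \<open>The added pairs have \<open>v + w\<close> of degree above \<open>d\<close>, so
    their monomial has order above \<open>d\<close>.\<close>
  also have "\<dots> = (\<Sum>p\<in>?E \<times> ?E. ?t p)"
  proof (rule sum.mono_neutral_left)
    show "\<forall>p\<in>?E \<times> ?E - {p \<in> ?E \<times> ?E. fst p + snd p \<in> ?E}. ?t p = 0"
      by (auto simp: exps_iff keys_add_nat intro!: monom_eval_nth)
  qed (auto simp: finite_exps)
  also have "\<dots> = (\<Sum>v\<in>?E. \<Sum>w\<in>?E. F v * G w * ?m (v + w) $ d)"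
    by (simp add: sum.cartesian_product)
  also have "\<dots> = (\<Sum>v\<in>?E. \<Sum>w\<in>?E. \<Sum>i=0..d. (F v * ?m v $ i) * (G w * ?m w $ (d - i)))"
    by (simp add: monom_eval_add fps_mult_nth sum_distrib_left algebra_simps)
  also have "\<dots> = (\<Sum>v\<in>?E. \<Sum>i=0..d. \<Sum>w\<in>?E. (F v * ?m v $ i) * (G w * ?m w $ (d - i)))"
    by (intro sum.cong refl sum.swap)
  also have "\<dots> = (\<Sum>i=0..d. \<Sum>v\<in>?E. \<Sum>w\<in>?E. (F v * ?m v $ i) * (G w * ?m w $ (d - i)))"
    by (rule sum.swap)
  also have "\<dots> = (\<Sum>i=0..d. ev n x F $ i * ev n x G $ (d - i))"
    by (intro sum.cong refl) (simp add: ev_nth[of _ d] sum_product)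
  also have "\<dots> = (ev n x F * ev n x G) $ d" by (simp add: fps_mult_nth)
  finally show "ev n x (mps_mult F G) $ d = (ev n x F * ev n x G) $ d" .
qed

text \<open>The difference of both sides is a derivation that vanishes on constants and variables,
  so each splitting-off of variables raises its order in \<open>t\<close>.\<close>

lemma fps_deriv_ev:
  assumes "F \<in> PS n"
  shows "fps_deriv (ev n x F) = (\<Sum>i<n. ev n x (mps_deriv i F) * fps_deriv (x i))"
proof -
  define \<Delta> where "\<Delta> F = fps_deriv (ev n x F) - (\<Sum>i<n. ev n x (mps_deriv i F) * fps_deriv (x i))" for F
  have add: "\<Delta> (F + G) = \<Delta> F + \<Delta> G" for F G
    unfolding \<Delta>_def mps_deriv_add ev_add by (simp add: algebra_simps sum.distrib)
  have zero: "\<Delta> 0 = 0" by (simp add: \<Delta>_def mps_deriv_0 ev_0)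
  have sum: "\<Delta> (\<Sum>i\<in>A. H i) = (\<Sum>i\<in>A. \<Delta> (H i))" for A :: "nat set" and H
    by (induction A rule: infinite_finite_induct)
       (simp_all add: zero add del: zero_fun_apply plus_fun_apply)
  have const: "\<Delta> (mps_const c) = 0" for c
    by (simp add: \<Delta>_def mps_deriv_const ev_const ev_0)
  have var: "\<Delta> (mps_mult (mps_var j) G) = x j * \<Delta> G" if "j < n" for j G
  proof -
    have "(\<Sum>i<n. ev n x (mps_deriv i (mps_var j)) * ev n x G * fps_deriv (x i)) =
        (\<Sum>i<n. if i = j then ev n x G * fps_deriv (x j) else 0)"
      by (rule sum.cong) (auto simp: mps_deriv_var ev_const)
    also have "\<dots> = ev n x G * fps_deriv (x j)" using that by simp
    finally show ?thesis
      unfolding \<Delta>_def mps_deriv_mult ev_add ev_mult ev_var[OF that]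
      by (simp add: algebra_simps sum.distrib sum_distrib_left)
  qed
  have "fps_X ^ k dvd \<Delta> F" if "F \<in> PS n" for k F
    using that
  proof (induction k arbitrary: F)
    case (Suc k)
    obtain G where G: "\<And>i. i < n \<Longrightarrow> G i \<in> PS n"
      "F = mps_const (F 0) + (\<Sum>i<n. mps_mult (mps_var i) (G i))"
      using mps_decomp[OF Suc.prems] by metis
    have "\<Delta> F = (\<Sum>i<n. x i * \<Delta> (G i))"
      by (subst G(2), simp only: add const sum) (simp add: var)
    moreover have "fps_X ^ Suc k dvd x i * \<Delta> (G i)" if "i < n" for i
      using Suc.IH[OF G(1)[OF that]] x_nth_0[OF that] fps_X_power_dvd_iff[of 1 "x i"]
      by (auto intro!: mult_dvd_mono)
    ultimately show ?case by (auto intro: dvd_sum)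
  qed simp
  then have "\<Delta> F = 0" using assms by (intro fps_eq_0_if_dvd_all) auto
  then show ?thesis by (simp add: \<Delta>_def)
qed

end

section \<open>Derivations of subrings of power series rings\<close>

lemma fls_times_X_power_fps: 
  fixes q :: "'k::field fls"
  obtains M h where "fls_X ^ M * q = fps_to_fls h"
proof (cases "q = 0")
  case True
  then show ?thesis using that[of 0 0] by simp
next
  case False
  have "fls_subdegree (fls_X ^ nat (- fls_subdegree q) * q) \<ge> 0"
    using False by simp
  then show ?thesis
    using that fls_regpart_to_fls_trivial by metis
qed

text \<open>The common pole bound \<open>M\<close> stands in for continuity. The difference
  \<open>\<eta>\<close> of the two sides satisfies
  \<open>\<eta> g = t \<eta> (fps_shift 1 g)\<close>; after multiplication by one fixed power of
  \<open>t\<close> its values are power series divisible by every power of \<open>t\<close>, hence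
  zero.\<close>

lemma bounded_derivation_fps:
  fixes \<delta> :: "'k::field fps \<Rightarrow> 'k fls"
  assumes add: "\<And>g h. \<delta> (g + h) = \<delta> g + \<delta> h"
    and mult: "\<And>g h. \<delta> (g * h) = fps_to_fls g * \<delta> h + fps_to_fls h * \<delta> g"
    and const: "\<And>c. \<delta> (fps_const c) = 0"
    and bound: "\<And>g. \<exists>h. fls_X ^ M * \<delta> g = fps_to_fls h"
  shows "\<delta> g = \<delta> fps_X * fps_to_fls (fps_deriv g)"
proof -
  define \<eta> where "\<eta> g = \<delta> g - \<delta> fps_X * fps_to_fls (fps_deriv g)" for g
  have step: "\<eta> g = fls_X * \<eta> (fps_shift 1 g)" for g
  proof -
    have g: "g = fps_const (g $ 0) + fps_X * fps_shift 1 g"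
      by (rule fps_ext) (simp add: fps_X_mult_nth)
    have "\<delta> g = fls_X * \<delta> (fps_shift 1 g) + fps_to_fls (fps_shift 1 g) * \<delta> fps_X"
      by (subst g, simp only: add const mult fps_X_to_fls) simp
    moreover have "fps_deriv g = fps_X * fps_deriv (fps_shift 1 g) + fps_shift 1 g"
      by (subst g) simp
    ultimately show ?thesis
      by (simp add: \<eta>_def algebra_simps fls_times_fps_to_fls)
  qed
  obtain N h0 where N: "fls_X ^ N * \<delta> fps_X = fps_to_fls h0" by (rule fls_times_X_power_fps)
  have bd: "\<exists>h. fls_X ^ (M + N) * \<eta> g = fps_to_fls h" for g
  proof -
    obtain h where h: "fls_X ^ M * \<delta> g = fps_to_fls h" using bound by blast
    have "fls_X ^ (M + N) * \<eta> g =
        fls_X ^ N * (fls_X ^ M * \<delta> g) - fls_X ^ M * (fls_X ^ N * \<delta> fps_X) * fps_to_fls (fps_deriv g)"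
      by (simp add: \<eta>_def algebra_simps power_add)
    also have "\<dots> = fps_to_fls (fps_X ^ N * h - fps_X ^ M * h0 * fps_deriv g)"
      by (simp add: h N fls_times_fps_to_fls fps_to_fls_power)
    finally show ?thesis by blast
  qed
  have "\<exists>h. fls_X ^ (M + N) * \<eta> g = fps_to_fls (fps_X ^ k * h)" for k g
  proof (induction k arbitrary: g)
    case 0
    then show ?case using bd by simp
  next
    case (Suc k)
    obtain h where h: "fls_X ^ (M + N) * \<eta> (fps_shift 1 g) = fps_to_fls (fps_X ^ k * h)"
      using Suc.IH[of "fps_shift 1 g"] by metis
    have "fls_X ^ (M + N) * \<eta> g = fls_X * (fls_X ^ (M + N) * \<eta> (fps_shift 1 g))"
      by (subst step) (rule mult.left_commute)
    also have "\<dots> = fps_to_fls (fps_X ^ Suc k * h)"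
      unfolding h by (simp add: fls_times_fps_to_fls mult.assoc)
    finally show ?case by blast
  qed
  then have dvd: "\<exists>h. fls_X ^ (M + N) * \<eta> g = fps_to_fls h \<and> fps_X ^ k dvd h" for k
    by (meson dvd_triv_left)
  obtain h where h: "fls_X ^ (M + N) * \<eta> g = fps_to_fls h" using bd by blast
  have "h = 0" by (rule fps_eq_0_if_dvd_all) (use dvd h in \<open>metis fps_to_fls_eq_iff\<close>)
  then have "\<eta> g = 0" using h by simp
  then show ?thesis by (simp add: \<eta>_def)
qed

text \<open>A derivation of a subring \<open>A\<close> containing \<open>t\<^sup>N k[[t]]\<close> extends to \<open>k[[t]]\<close> through
  \<open>g = (t\<^sup>N g) / t\<^sup>N\<close>.\<close>

lemma bounded_derivation_subring:
  fixes D :: "'k::field fps \<Rightarrow> 'k fls" and A :: "'k fps set"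
  assumes mem: "\<And>h. fps_X ^ N * h \<in> A"
    and add: "\<And>g h. g \<in> A \<Longrightarrow> h \<in> A \<Longrightarrow> D (g + h) = D g + D h"
    and mult: "\<And>g h. g \<in> A \<Longrightarrow> h \<in> A \<Longrightarrow> D (g * h) = fps_to_fls g * D h + fps_to_fls h * D g"
    and const: "\<And>c g. g \<in> A \<Longrightarrow> D (fps_const c * g) = fls_const c * D g"
    and bound: "\<And>g. g \<in> A \<Longrightarrow> \<exists>h. fls_X ^ M * D g = fps_to_fls h"
  obtains \<epsilon> where "\<And>g. g \<in> A \<Longrightarrow> D g = \<epsilon> * fps_to_fls (fps_deriv g)"
proof -
  define T :: "'k fps" where "T = fps_X ^ N"
  define \<tau> where "\<tau> = fps_to_fls T"
  have T0: "T \<noteq> 0" by (simp add: T_def)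
  have \<tau>0: "\<tau> \<noteq> 0" by (simp add: \<tau>_def T0)
  have Tm: "T * h \<in> A" for h using mem by (simp add: T_def)
  have T1: "T \<in> A" using Tm[of 1] by simp
  define \<delta> where "\<delta> g = (D (T * g) - fps_to_fls g * D T) / \<tau>" for g
  have \<delta>: "\<tau> * \<delta> g = D (T * g) - fps_to_fls g * D T" for g
    using \<tau>0 by (simp add: \<delta>_def)
  have d_add: "\<delta> (g + h) = \<delta> g + \<delta> h" for g h
    by (simp add: \<delta>_def distrib_left add Tm distrib_right add_divide_distrib diff_divide_distrib)
  have d_const: "\<delta> (fps_const c) = 0" for c
    using const[OF T1, of c] by (simp add: \<delta>_def mult.commute)
  have d_mult: "\<delta> (g * h) = fps_to_fls g * \<delta> h + fps_to_fls h * \<delta> g" for g h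
  proof -
    \<comment> \<open>\<open>D (T T g h)\<close> is computed twice, from \<open>(T g)(T h)\<close>
      and from \<open>T (T (g h))\<close>. In both splittings all factors lie in \<open>A\<close>,
      whereas \<open>g\<close> and \<open>h\<close> themselves need not.\<close>
    have "D ((T * g) * (T * h)) = \<tau> * fps_to_fls g * D (T * h) + \<tau> * fps_to_fls h * D (T * g)"
      by (subst mult[OF Tm Tm]) (simp add: \<tau>_def fls_times_fps_to_fls)
    moreover have "D (T * (T * (g * h))) = \<tau> * D (T * (g * h)) + \<tau> * (fps_to_fls g * fps_to_fls h) * D T"
      by (subst mult[OF T1 Tm]) (simp add: \<tau>_def fls_times_fps_to_fls)
    ultimately have e: "\<tau> * D (T * (g * h)) + \<tau> * (fps_to_fls g * fps_to_fls h) * D T =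
        \<tau> * fps_to_fls g * D (T * h) + \<tau> * fps_to_fls h * D (T * g)"
      by (simp add: ac_simps)
    then have e': "\<tau> * D (T * (g * h)) = \<tau> * fps_to_fls g * D (T * h) + \<tau> * fps_to_fls h * D (T * g)
        - \<tau> * (fps_to_fls g * fps_to_fls h) * D T"
      by (simp only: eq_diff_eq)
    have "\<tau> * (\<tau> * \<delta> (g * h)) = \<tau> * (fps_to_fls g * (\<tau> * \<delta> h) + fps_to_fls h * (\<tau> * \<delta> g))"
      unfolding \<delta> fls_times_fps_to_fls right_diff_distrib e'[unfolded fls_times_fps_to_fls]
      by (simp add: algebra_simps)
    also have "\<dots> = \<tau> * (\<tau> * (fps_to_fls g * \<delta> h + fps_to_fls h * \<delta> g))"
      by (simp add: algebra_simps)
    finally show ?thesis using \<tau>0 by simp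
  qed
  have d_bound: "\<exists>h. fls_X ^ (M + N) * \<delta> g = fps_to_fls h" for g
  proof -
    obtain h1 where h1: "fls_X ^ M * D (T * g) = fps_to_fls h1" using bound[OF Tm] by blast
    obtain h2 where h2: "fls_X ^ M * D T = fps_to_fls h2" using bound[OF T1] by blast
    have "fls_X ^ (M + N) * \<delta> g = fls_X ^ M * (\<tau> * \<delta> g)"
      by (simp add: power_add \<tau>_def T_def fps_to_fls_power)
    also have "\<dots> = fps_to_fls (h1 - g * h2)"
      unfolding \<delta> right_diff_distrib h1 mult.left_commute[of "fls_X ^ M"] h2
      by (simp add: fls_times_fps_to_fls)
    finally show ?thesis by blast
  qed
  have der: "\<delta> g = \<delta> fps_X * fps_to_fls (fps_deriv g)" for g
    using bounded_derivation_fps[OF d_add d_mult d_const d_bound] .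
  have "D g = \<delta> fps_X * fps_to_fls (fps_deriv g)" if "g \<in> A" for g
  proof -
    have "\<tau> * \<delta> g = \<tau> * D g"
      unfolding \<delta> by (subst mult[OF T1 that]) (simp add: \<tau>_def)
    then show ?thesis using \<tau>0 der[of g] by simp
  qed
  then show thesis using that by blast
qed

section \<open>The Euler derivation of a quasi-homogeneous algebra\<close>

lemma mps_const_0: "mps_const 0 = 0"
  by (simp add: mps_const_def fun_eq_iff)

lemma mps_var_nth_0: "mps_var i 0 = 0"
  using add_unit_exp_neq_0[of 0 i] by (auto simp: mps_var_def)

lemma ideal_mpsI:
  assumes "I \<subseteq> PS n" "0 \<in> I" "\<And>F G. F \<in> I \<Longrightarrow> G \<in> I \<Longrightarrow> F + G \<in> I"
    and mult: "\<And>F G. F \<in> PS n \<Longrightarrow> G \<in> I \<Longrightarrow> mps_mult F G \<in> I"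
  shows "ideal I (mps_ring n :: 'k::comm_ring_1 mps ring)"
proof -
  interpret cring "mps_ring n :: 'k mps ring" by (rule cring_mps_ring)
  let ?M = "mps_ring n :: 'k mps ring"
  show ?thesis
  proof (rule idealI)
    show "subgroup I (add_monoid ?M)"
    proof (rule group.subgroupI)
      show "Group.group (add_monoid ?M)" by (rule a_group)
    next
      fix F assume F: "F \<in> I"
      have FPS: "F \<in> PS n" using F assms(1) by blast
      have "mps_mult (mps_const (-1)) F = - F" by (simp add: fun_eq_iff mps_mult_const)
      then have "- F \<in> I" using mult[OF PS_const F, of "-1"] by simp
      moreover have "\<ominus>\<^bsub>?M\<^esub> F = - F"
        by (rule minus_equality) (use FPS PS_uminus[OF FPS] in \<open>simp_all add: mps_ring_simps\<close>)
      ultimately show "inv\<^bsub>add_monoid ?M\<^esub> F \<in> I" by (simp add: a_inv_def)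
    qed (use assms in \<open>auto simp: mps_ring_simps\<close>)
  next
    fix a F :: "'k mps" assume a: "a \<in> I" and F: "F \<in> PS n"
    show "F \<otimes>\<^bsub>?M\<^esub> a \<in> I" "a \<otimes>\<^bsub>?M\<^esub> F \<in> I"
      using mult[OF F a] by (simp_all add: mps_ring_simps mps_mult_commute)
  qed (rule ring_axioms)
qed

lemma fls_subring_simps:
  "carrier (fls_subring S) = S" "monoid.mult (fls_subring S) = (*)" "ring.add (fls_subring S) = (+)"
  "monoid.one (fls_subring S) = 1" "ring.zero (fls_subring S) = 0"
  by (simp_all add: fls_subring_def fls_ring_def ring_of_type_algebra_def)

text \<open>On \<open>PS m\<close> this is the Euler derivation, the sum of the
  \<open>w_i X_i d/dX_i\<close>.\<close>

definition mps_euler :: "nat \<Rightarrow> (nat \<Rightarrow> nat) \<Rightarrow> 'k::comm_ring_1 mps \<Rightarrow> 'k mps" where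
  "mps_euler m w F = (\<lambda>u. of_nat (exp_weight m w u) * F u)"

lemma mps_euler_add: "mps_euler m w (F + G) = mps_euler m w F + mps_euler m w G"
  by (simp add: mps_euler_def fun_eq_iff algebra_simps)

lemma mps_euler_0: "mps_euler m w 0 = 0"
  by (simp add: mps_euler_def fun_eq_iff)

lemma mps_euler_mult:
  "mps_euler m w (mps_mult F G) = mps_mult (mps_euler m w F) G + mps_mult F (mps_euler m w G)"
proof
  fix u
  have "mps_euler m w (mps_mult F G) u =
      (\<Sum>(a, b)\<in>{(a, b). a + b = u}. of_nat (exp_weight m w u) * (F a * G b))"
    by (simp add: mps_euler_def mps_mult_def sum_distrib_left case_prod_unfold)
  also have "\<dots> = (\<Sum>(a, b)\<in>{(a, b). a + b = u}.
      of_nat (exp_weight m w a) * F a * G b + F a * (of_nat (exp_weight m w b) * G b))"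
    by (rule sum.cong) (auto simp: exp_weight_add algebra_simps)
  also have "\<dots> = mps_mult (mps_euler m w F) G u + mps_mult F (mps_euler m w G) u"
    by (simp add: mps_euler_def mps_mult_def sum.distrib case_prod_unfold)
  finally show "mps_euler m w (mps_mult F G) u = (mps_mult (mps_euler m w F) G + mps_mult F (mps_euler m w G)) u"
    by simp
qed

lemma mps_euler_const: "mps_euler m w (mps_const c) = 0"
  by (auto simp: mps_euler_def mps_const_def fun_eq_iff exp_weight_0)

lemma PS_euler: "F \<in> PS m \<Longrightarrow> mps_euler m w F \<in> PS m"
  unfolding PS_iff mps_euler_def by (metis mult_zero_right)

lemma mps_euler_homogeneous:
  assumes "\<And>u. F u \<noteq> 0 \<Longrightarrow> exp_weight m w u = d"
  shows "mps_euler m w F = mps_mult (mps_const (of_nat d)) F"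
proof
  fix u show "mps_euler m w F u = mps_mult (mps_const (of_nat d)) F u"
    using assms[of u] by (cases "F u = 0") (simp_all add: mps_euler_def mps_mult_const)
qed

text \<open>By the product rule, the elements of the ideal whose Euler image is again in the ideal
  form an ideal. It contains the generators, which are eigenvectors, so it is everything.\<close>

lemma genideal_homogeneous_euler_closed:
  fixes P :: "'k::comm_ring_1 mps set"
  assumes "\<forall>F\<in>P. weighted_homogeneous_poly m w F" and F: "F \<in> genideal (mps_ring m) P"
  shows "mps_euler m w F \<in> genideal (mps_ring m) P"
proof -
  interpret cring "mps_ring m :: 'k mps ring" by (rule cring_mps_ring)
  define J where "J = genideal (mps_ring m) P"
  have P: "P \<subseteq> PS m" using assms by (auto simp: weighted_homogeneous_poly_def)
  interpret J: ideal J "mps_ring m" unfolding J_def by (rule genideal_ideal[OF P])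
  have PJ: "P \<subseteq> J" unfolding J_def by (rule genideal_self[OF P])
  have J0: "0 \<in> J" using J.zero_closed by (simp add: mps_ring_simps)
  have Ja: "F + G \<in> J" if "F \<in> J" "G \<in> J" for F G
    using J.a_closed[OF that] by (simp add: mps_ring_simps)
  have Jm: "mps_mult F G \<in> J" if "F \<in> PS m" "G \<in> J" for F G
    using J.I_l_closed[OF that(2,1)] by (simp add: mps_ring_simps)
  have "ideal {F \<in> J. mps_euler m w F \<in> J} (mps_ring m)"
  proof (rule ideal_mpsI)
    show "{F \<in> J. mps_euler m w F \<in> J} \<subseteq> PS m" using J.a_subset by auto
  next
    fix F G :: "'k mps" assume "F \<in> PS m" and G: "G \<in> {F \<in> J. mps_euler m w F \<in> J}"
    moreover have "mps_mult (mps_euler m w F) G \<in> J"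
      using Jm[OF PS_euler[OF \<open>F \<in> PS m\<close>]] G by simp
    ultimately show "mps_mult F G \<in> {F \<in> J. mps_euler m w F \<in> J}"
      by (simp add: mps_euler_mult Ja Jm del: plus_fun_apply)
  qed (simp_all add: J0 Ja mps_euler_add mps_euler_0 del: plus_fun_apply zero_fun_apply)
  moreover have "P \<subseteq> {F \<in> J. mps_euler m w F \<in> J}"
  proof clarify
    fix F assume F: "F \<in> P"
    then obtain d where d: "\<And>u. F u \<noteq> 0 \<Longrightarrow> exp_weight m w u = d"
      using assms(1) unfolding weighted_homogeneous_poly_def exp_weight_def by blast
    have "mps_euler m w F = mps_mult (mps_const (of_nat d)) F"
      using mps_euler_homogeneous[OF d] .
    then show "F \<in> J \<and> mps_euler m w F \<in> J"
      using F PJ Jm[OF PS_const] by auto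
  qed
  ultimately have "J \<subseteq> {F \<in> J. mps_euler m w F \<in> J}"
    unfolding J_def by (intro genideal_minimal)
  then show ?thesis using F by (auto simp: J_def)
qed

text \<open>The Euler derivation of the weighted polynomial ring descends to \<open>S\<close>, where it is of the
  form \<open>\<epsilon> d/dt\<close>; the \<open>z d\<close> are the images of the homogeneous components.\<close>

lemma quasi_homogeneous_eigenvectors:
  fixes S :: "'k::field fls set"
  assumes qh: "quasi_homogeneous fls_const (fls_subring S)"
    and sub: "S \<subseteq> range fps_to_fls"
    and mem: "\<And>h. fps_to_fls (fps_X ^ N * h) \<in> S"
  obtains \<epsilon> where "\<And>g K. fps_to_fls g \<in> S \<Longrightarrow> \<exists>L z. z 0 = fps_const (g $ 0) \<and>
      (\<forall>d. fps_to_fls (z d) \<in> S \<and> (0 < d \<longrightarrow> z d $ 0 = 0) \<and>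
        \<epsilon> * fps_to_fls (fps_deriv (z d)) = of_nat d * fps_to_fls (z d)) \<and>
      fps_X ^ K dvd g - (\<Sum>d<L. z d)"
proof -
  obtain m w P J h where w: "\<forall>i<m. 0 < w i" and P: "\<forall>F\<in>P. weighted_homogeneous_poly m w F"
    and J: "J = genideal (mps_ring m) P" and h: "h \<in> ring_iso (mps_ring m Quot J) (fls_subring S)"
    and hc: "\<And>c. h (J +>\<^bsub>mps_ring m\<^esub> mps_const c) = fls_const c"
    using qh unfolding quasi_homogeneous_def by blast
  interpret cring "mps_ring m :: 'k mps ring" by (rule cring_mps_ring)
  have PPS: "P \<subseteq> PS m" using P by (auto simp: weighted_homogeneous_poly_def)
  interpret J: ideal J "mps_ring m" unfolding J by (rule genideal_ideal[OF PPS])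
  define \<pi> where "\<pi> = h \<circ> (\<lambda>F. J +>\<^bsub>mps_ring m\<^esub> F)"
  have hom: "\<pi> \<in> Ring.ring_hom (mps_ring m) (fls_subring S)"
    unfolding \<pi>_def using J.rcos_ring_hom h by (auto simp: ring_iso_def intro: Ring.ring_hom_trans)
  have \<pi>S: "\<pi> F \<in> S" if "F \<in> PS m" for F
    using Ring.ring_hom_closed[OF hom that] by (simp add: fls_subring_simps)
  have \<pi>add: "\<pi> (F + G) = \<pi> F + \<pi> G" if "F \<in> PS m" "G \<in> PS m" for F G
    using Ring.ring_hom_add[OF hom that] by (simp add: fls_subring_simps mps_ring_simps)
  have \<pi>mult: "\<pi> (mps_mult F G) = \<pi> F * \<pi> G" if "F \<in> PS m" "G \<in> PS m" for F G
    using Ring.ring_hom_mult[OF hom that] by (simp add: fls_subring_simps mps_ring_simps)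
  have \<pi>const: "\<pi> (mps_const c) = fls_const c" for c
    using hc by (simp add: \<pi>_def)
  have \<pi>0: "\<pi> 0 = 0"
    using \<pi>const[of 0] by (simp add: mps_const_0)
  have \<pi>diff: "\<pi> (F - G) = \<pi> F - \<pi> G" if "F \<in> PS m" "G \<in> PS m" for F G
    using \<pi>add[OF PS_diff[OF that] that(2)] by simp
  have \<pi>sum: "\<pi> (\<Sum>i\<in>A. H i) = (\<Sum>i\<in>A. \<pi> (H i))" if "\<And>i. i \<in> A \<Longrightarrow> H i \<in> PS m" for A :: "nat set" and H
    using that
    by (induction A rule: infinite_finite_induct)
       (simp_all add: \<pi>0 \<pi>add PS_sum del: plus_fun_apply zero_fun_apply)
  have ker: "F \<in> J" if "F \<in> PS m" "\<pi> F = 0" for F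
  proof -
    have bij: "inj_on h (carrier (mps_ring m Quot J))"
      using h by (auto simp: ring_iso_def bij_betw_def)
    have "h (J +>\<^bsub>mps_ring m\<^esub> F) = h (J +>\<^bsub>mps_ring m\<^esub> 0)"
      using that \<pi>0 by (simp add: \<pi>_def)
    then have "J +>\<^bsub>mps_ring m\<^esub> F = J +>\<^bsub>mps_ring m\<^esub> 0"
      by (rule inj_onD[OF bij]) (use that PS_0[of m] in \<open>auto simp: FactRing_def intro: a_rcosetsI J.a_subset\<close>)
    also have "\<dots> = J" using a_coset_add_zero[OF J.a_subset] by (simp add: mps_ring_simps)
    finally show ?thesis
      using J.a_rcos_self[OF that(1)] by simp
  qed
  have surj: "\<exists>F\<in>PS m. \<pi> F = q" if "q \<in> S" for q
  proof -
    have "q \<in> h ` carrier (mps_ring m Quot J)"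
      using h that unfolding ring_iso_def bij_betw_def fls_subring_simps by simp
    then show ?thesis by (auto simp: FactRing_def A_RCOSETS_def' \<pi>_def)
  qed
  define E :: "'k mps \<Rightarrow> 'k mps" where "E = mps_euler m w"
  have EPS: "E F \<in> PS m" if "F \<in> PS m" for F using that by (simp add: E_def PS_euler)
  have Eadd: "E (F + G) = E F + E G" for F G by (simp add: E_def mps_euler_add)
  have Ediff: "E (F - G) = E F - E G" for F G using Eadd[of "F - G" G] by simp
  have EJ: "\<pi> (E F) = 0" if "F \<in> PS m" "\<pi> F = 0" for F
  proof -
    have "E F \<in> J" using ker[OF that] genideal_homogeneous_euler_closed[OF P] by (simp add: E_def J)
    then have "J +>\<^bsub>mps_ring m\<^esub> E F = J +>\<^bsub>mps_ring m\<^esub> 0"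
      using J.a_rcos_const a_coset_add_zero[OF J.a_subset] by (simp add: mps_ring_simps)
    then show ?thesis using \<pi>0 by (simp add: \<pi>_def)
  qed
  define A where "A = {g. fps_to_fls g \<in> S}"
  define lift where "lift g = (SOME F. F \<in> PS m \<and> \<pi> F = fps_to_fls g)" for g
  have lift: "lift g \<in> PS m" "\<pi> (lift g) = fps_to_fls g" if "g \<in> A" for g
  proof -
    have "\<exists>F. F \<in> PS m \<and> \<pi> F = fps_to_fls g"
      using surj[of "fps_to_fls g"] that by (auto simp: A_def)
    from someI_ex[OF this] show "lift g \<in> PS m" "\<pi> (lift g) = fps_to_fls g"
      by (simp_all add: lift_def)
  qed
  \<comment> \<open>Independent of the chosen lift: two lifts differ by an element of
    \<open>J\<close>, which \<open>E\<close> maps into \<open>J\<close>.\<close>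
  define D where "D g = \<pi> (E (lift g))" for g
  have D: "D g = \<pi> (E F)" if "F \<in> PS m" "\<pi> F = fps_to_fls g" "g \<in> A" for F g
  proof -
    have "\<pi> (E (lift g - F)) = 0"
      using lift[OF that(3)] that by (intro EJ PS_diff) (simp_all add: \<pi>diff)
    then show ?thesis
      using lift[OF that(3)] that by (simp add: Ediff \<pi>diff EPS D_def)
  qed
  obtain \<epsilon> where \<epsilon>: "\<And>g. g \<in> A \<Longrightarrow> D g = \<epsilon> * fps_to_fls (fps_deriv g)"
  \<comment> \<open>The values of \<open>D\<close> lie in \<open>S\<close>, hence in
    \<open>k[[t]]\<close>: the pole bound is 0.\<close>
  proof (rule bounded_derivation_subring[of N A D 0])
    show "fps_X ^ N * h \<in> A" for h using mem by (simp add: A_def)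
    fix g h assume g: "g \<in> A" and h: "h \<in> A"
    have "\<pi> (lift g + lift h) = fps_to_fls (g + h)"
      by (simp add: \<pi>add lift g h)
    moreover have "g + h \<in> A"
      using \<pi>S[OF PS_add[OF lift(1)[OF g] lift(1)[OF h]]] calculation by (simp add: A_def)
    ultimately show "D (g + h) = D g + D h"
      using D[of "lift g + lift h" "g + h"] by (simp add: PS_add lift g h Eadd EPS \<pi>add D_def)
    have m: "\<pi> (mps_mult (lift g) (lift h)) = fps_to_fls (g * h)"
      by (simp add: \<pi>mult lift g h fls_times_fps_to_fls)
    moreover have "g * h \<in> A"
      using \<pi>S[OF PS_mult[OF lift(1)[OF g] lift(1)[OF h]]] m by (simp add: A_def)
    ultimately show "D (g * h) = fps_to_fls g * D h + fps_to_fls h * D g"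
      using D[of "mps_mult (lift g) (lift h)" "g * h"]
      by (simp add: E_def mps_euler_mult PS_mult lift g h PS_euler \<pi>mult \<pi>add D_def)
  next
    fix c g assume g: "g \<in> A"
    have m: "\<pi> (mps_mult (mps_const c) (lift g)) = fps_to_fls (fps_const c * g)"
      by (simp add: \<pi>mult lift g fls_times_fps_to_fls \<pi>const PS_const)
    moreover have "fps_const c * g \<in> A"
      using \<pi>S[OF PS_mult[OF PS_const lift(1)[OF g]], of c] m by (simp add: A_def)
    ultimately have "D (fps_const c * g) = \<pi> (E (mps_mult (mps_const c) (lift g)))"
      using D PS_mult[OF PS_const lift(1)[OF g]] by blast
    also have "E (mps_mult (mps_const c) (lift g)) = mps_mult (mps_const c) (E (lift g))"
      unfolding E_def mps_euler_mult mps_euler_const mps_mult_0_left by (rule add_0)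
    also have "\<pi> \<dots> = fls_const c * D g"
      by (simp add: \<pi>mult PS_const EPS lift g \<pi>const D_def)
    finally show "D (fps_const c * g) = fls_const c * D g" .
  next
    fix g assume g: "g \<in> A"
    show "\<exists>h. fls_X ^ 0 * D g = fps_to_fls h"
      using \<pi>S[OF EPS[OF lift(1)[OF g]]] sub by (auto simp: D_def)
  next
    fix \<epsilon> assume a: "\<And>g. g \<in> A \<Longrightarrow> D g = \<epsilon> * fps_to_fls (fps_deriv g)"
    show thesis by (rule that[OF a])
  qed
  define p where "p F = fls_regpart (\<pi> F)" for F
  have p: "\<pi> F = fps_to_fls (p F)" if "F \<in> PS m" for F
    using \<pi>S[OF that] sub by (auto simp: p_def)
  have pm: "p (mps_mult F G) = p F * p G" if "F \<in> PS m" "G \<in> PS m" for F G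
  proof -
    have "fps_to_fls (p (mps_mult F G)) = fps_to_fls (p F * p G)"
      using \<pi>mult[OF that] p[OF PS_mult[OF that]] p that by (simp add: fls_times_fps_to_fls)
    then show ?thesis by simp
  qed
  have pc: "p (mps_const c) = fps_const c" for c
  proof -
    have "fps_to_fls (p (mps_const c)) = fps_to_fls (fps_const c)"
      using p[OF PS_const] \<pi>const by simp
    then show ?thesis by (simp only: fps_to_fls_eq_iff)
  qed
  \<comment> \<open>If the value had constant term \<open>c \<noteq> 0\<close>, then
    \<open>F - c\<close> would be a unit, although its value has no constant term.\<close>
  have local: "p F $ 0 = 0" if F: "F \<in> PS m" "F 0 = 0" for F
  proof (rule ccontr)
    assume nz: "p F $ 0 \<noteq> 0"
    define c where "c = p F $ 0"
    have GPS: "F - mps_const c \<in> PS m" by (intro PS_diff PS_const F)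
    have "(F - mps_const c) 0 \<noteq> 0" using F nz by (simp add: mps_const_def c_def)
    then obtain H where H: "H \<in> PS m" "mps_mult (F - mps_const c) H = mps_const 1"
      using mps_inverse[OF GPS] by blast
    have "p (F - mps_const c) * p H = 1"
      using pm[OF GPS H(1)] H(2) pc[of 1] by simp
    then have "p (F - mps_const c) $ 0 * p H $ 0 = 1"
      by (metis fps_mult_nth_0 fps_one_nth)
    moreover have "p (F - mps_const c) = p F - fps_const c"
      using \<pi>diff[OF F(1) PS_const, of c] p[OF GPS] p[OF F(1)] \<pi>const[of c]
      by (metis fps_const_to_fls fps_to_fls_eq_iff fps_to_fls_minus)
    ultimately show False by (simp add: c_def)
  qed
  \<comment> \<open>This is the continuity of \<open>\<pi>\<close>: each variable split off from
    \<open>F\<close> contributes a factor \<open>t\<close>.\<close>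
  have order: "fps_X ^ K dvd p F" if "F \<in> PS m" "\<And>u. F u \<noteq> 0 \<Longrightarrow> K \<le> exp_deg m u" for K F
    using that
  proof (induction K arbitrary: F)
    case (Suc K)
    obtain G where G: "\<And>i. i < m \<Longrightarrow> G i \<in> PS m"
      "F = mps_const (F 0) + (\<Sum>i<m. mps_mult (mps_var i) (G i))"
      "\<And>i u. G i u \<noteq> 0 \<Longrightarrow> F (u + unit_exp i) \<noteq> 0"
      using mps_decomp[OF Suc.prems(1)] by blast
    have F0: "F 0 = 0" using Suc.prems(2)[of 0] by (auto simp: exp_weight_0)
    have "fps_X ^ K dvd p (G i)" if i: "i < m" for i
    proof (rule Suc.IH[OF G(1)[OF i]])
      fix u assume "G i u \<noteq> 0"
      then have "Suc K \<le> exp_deg m (u + unit_exp i)" using G(3) Suc.prems(2) by blast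
      then show "K \<le> exp_deg m u" using exp_deg_unit[OF i] by (simp add: exp_weight_add)
    qed
    moreover have "fps_X dvd p (mps_var i)" if "i < m" for i
      using local[OF PS_var[OF that] mps_var_nth_0] fps_X_power_dvd_iff[of 1 "p (mps_var i)"] by simp
    ultimately have d: "fps_X ^ Suc K dvd p (mps_var i) * p (G i)" if "i < m" for i
      using that by (auto intro!: mult_dvd_mono)
    have "F = (\<Sum>i<m. mps_mult (mps_var i) (G i))"
      using G(2) unfolding F0 mps_const_0 add_0 .
    then have "\<pi> F = \<pi> (\<Sum>i<m. mps_mult (mps_var i) (G i))" by (rule arg_cong)
    also have "\<dots> = (\<Sum>i<m. \<pi> (mps_mult (mps_var i) (G i)))"
      by (rule \<pi>sum) (auto intro: PS_mult PS_var G(1))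
    also have "\<dots> = (\<Sum>i<m. fps_to_fls (p (mps_var i) * p (G i)))"
      by (rule sum.cong) (simp_all add: \<pi>mult PS_var G(1) p fls_times_fps_to_fls)
    also have "\<dots> = fps_to_fls (\<Sum>i<m. p (mps_var i) * p (G i))"
      by (induction m) simp_all
    finally have "p F = (\<Sum>i<m. p (mps_var i) * p (G i))"
      using p[OF Suc.prems(1)] by simp
    then show ?case using d by (auto intro!: dvd_sum)
  qed simp
  have "\<exists>L z. z 0 = fps_const (g $ 0) \<and> (\<forall>d. fps_to_fls (z d) \<in> S \<and> (0 < d \<longrightarrow> z d $ 0 = 0) \<and>
        \<epsilon> * fps_to_fls (fps_deriv (z d)) = of_nat d * fps_to_fls (z d)) \<and>
      fps_X ^ K dvd g - (\<Sum>d<L. z d)" if g: "fps_to_fls g \<in> S" for g K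
  proof -
    obtain F where F: "F \<in> PS m" "\<pi> F = fps_to_fls g" using surj[OF g] by blast
    define C where "C d = (\<lambda>u. if exp_weight m w u = d then F u else 0)" for d
    have CPS: "C d \<in> PS m" for d using F(1) by (auto simp: PS_iff C_def)
    define z where "z d = p (C d)" for d
    have zd: "\<pi> (C d) = fps_to_fls (z d)" for d using p[OF CPS] by (simp add: z_def)
    have zA: "z d \<in> A" for d using \<pi>S[OF CPS] zd by (simp add: A_def)
    have eig: "\<epsilon> * fps_to_fls (fps_deriv (z d)) = of_nat d * fps_to_fls (z d)" for d
    proof -
      have "E (C d) = mps_mult (mps_const (of_nat d)) (C d)"
        unfolding E_def by (rule mps_euler_homogeneous) (auto simp: C_def split: if_splits)
      then have "\<pi> (E (C d)) = of_nat d * fps_to_fls (z d)"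
        by (simp add: \<pi>mult PS_const CPS \<pi>const zd flip: fls_of_nat)
      then show ?thesis using \<epsilon>[OF zA] D[OF CPS zd zA] by simp
    qed
    \<comment> \<open>Positivity of the weights enters here: 1 is the only monomial of weight 0, so
      every nonconstant part has a positive eigenvalue.\<close>
    have C0: "C 0 = mps_const (F 0)"
    proof
      fix u
      have "u = 0" if "exp_weight m w u = 0" "F u \<noteq> 0"
      proof -
        have "\<forall>i<m. w i * Poly_Mapping.lookup u i = 0" using that(1) by (simp add: exp_weight_def)
        then have "\<forall>i<m. Poly_Mapping.lookup u i = 0" using w by (metis less_irrefl mult_is_0)
        then have "exp_deg m u = 0" by (simp add: exp_weight_def)
        moreover have "Poly_Mapping.keys u \<subseteq> {..<m}" using F(1) that(2) by (simp add: PS_iff)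
        ultimately show ?thesis by (intro exp_deg_eq_0)
      qed
      then show "C 0 u = mps_const (F 0) u" by (auto simp: C_def mps_const_def exp_weight_0)
    qed
    have F0: "F 0 = g $ 0"
    proof -
      have l: "p (F - mps_const (F 0)) $ 0 = 0"
        by (rule local[OF PS_diff[OF F(1) PS_const]]) (simp add: mps_const_def)
      have "fps_to_fls (p (F - mps_const (F 0))) = fps_to_fls (g - fps_const (F 0))"
        using \<pi>diff[OF F(1) PS_const, of "F 0"] p[OF PS_diff[OF F(1) PS_const], of "F 0"] F(2) \<pi>const[of "F 0"]
        by simp
      then have "p (F - mps_const (F 0)) = g - fps_const (F 0)"
        by (simp only: fps_to_fls_eq_iff)
      then show ?thesis using l by simp
    qed
    \<comment> \<open>\<open>W\<close> is positive and bounds every weight, so a monomial of weight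
      at least \<open>K * W\<close> has degree at least \<open>K\<close>; the part of
      \<open>F\<close> beyond weight \<open>L\<close> is then negligible modulo
      \<open>t^K\<close>.\<close>
    define W where "W = Suc (\<Sum>i<m. w i)"
    define L where "L = K * W"
    define Rm where "Rm = F - (\<Sum>d<L. C d)"
    have RPS: "Rm \<in> PS m" unfolding Rm_def by (intro PS_diff PS_sum F CPS)
    have sumC: "(\<Sum>d<L. C d) u = (if exp_weight m w u < L then F u else 0)" for u
      by (simp add: sum_fun_apply C_def)
    have "fps_X ^ K dvd p Rm"
    proof (rule order[OF RPS])
      fix u assume "Rm u \<noteq> 0"
      then have ge: "L \<le> exp_weight m w u" by (auto simp: Rm_def sumC split: if_splits)
      have "exp_weight m w u \<le> (\<Sum>i<m. W * Poly_Mapping.lookup u i)"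
        unfolding exp_weight_def
      proof (intro sum_mono mult_right_mono)
        fix i assume "i \<in> {..<m}"
        then have "w i \<le> (\<Sum>i<m. w i)" by (intro member_le_sum) auto
        then show "w i \<le> W" by (simp add: W_def)
      qed simp
      also have "\<dots> = W * exp_deg m u" by (simp add: exp_weight_def sum_distrib_left)
      finally have "W * K \<le> W * exp_deg m u" using ge by (simp only: L_def mult.commute[of K])
      then show "K \<le> exp_deg m u" by (subst (asm) mult_le_cancel1) (simp add: W_def)
    qed
    moreover have "p Rm = g - (\<Sum>d<L. z d)"
    proof -
      have "\<pi> Rm = fps_to_fls g - (\<Sum>d<L. fps_to_fls (z d))"
        unfolding Rm_def using F(2) by (simp add: \<pi>diff F(1) PS_sum CPS \<pi>sum zd)
      also have "(\<Sum>d<L. fps_to_fls (z d)) = fps_to_fls (\<Sum>d<L. z d)"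
        by (induction L) simp_all
      finally have "fps_to_fls (p Rm) = fps_to_fls (g - (\<Sum>d<L. z d))"
        using p[OF RPS] by simp
      then show ?thesis by (simp only: fps_to_fls_eq_iff)
    qed
    moreover have "z 0 = fps_const (g $ 0)" by (simp add: z_def C0 F0 pc)
    moreover have "z d $ 0 = 0" if "0 < d" for d
      unfolding z_def by (rule local[OF CPS]) (use that in \<open>simp add: C_def exp_weight_0\<close>)
    ultimately show ?thesis
      using zA eig unfolding A_def by (intro exI[of _ L] exI[of _ z]) auto
  qed
  then show thesis using that by blast
qed

section \<open>Maximal ideal, conductor and denominators\<close>

text \<open>Applied over \<open>k((t))\<close> to the Jacobian matrix: a vector outside the column
  span yields a functional that kills the columns, and such a functional is a derivation of
  \<open>R\<close>.\<close>

lemma span_or_functional: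
  fixes c :: "nat \<Rightarrow> nat \<Rightarrow> 'a::field" and v :: "nat \<Rightarrow> 'a"
  shows "(\<exists>q. \<forall>i<n. v i = (\<Sum>j<m. q j * c j i)) \<or>
    (\<exists>p. (\<forall>j<m. (\<Sum>i<n. c j i * p i) = 0) \<and> (\<Sum>i<n. v i * p i) = 1)"
proof (induction m arbitrary: v)
  case 0
  show ?case
  proof (cases "\<forall>i<n. v i = 0")
    case False
    then obtain i0 where i0: "i0 < n" "v i0 \<noteq> 0" by blast
    have "(\<Sum>i<n. v i * (if i = i0 then 1 / v i0 else 0)) = (\<Sum>i<n. if i = i0 then 1 else 0)"
      using i0(2) by (intro sum.cong) auto
    then have "(\<Sum>i<n. v i * (if i = i0 then 1 / v i0 else 0)) = 1" using i0(1) by simp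
    then show ?thesis by (intro disjI2 exI[of _ "\<lambda>i. if i = i0 then 1 / v i0 else 0"]) simp
  qed simp
next
  case (Suc m)
  have ext: ?case if "\<forall>i<n. v i = (\<Sum>j<m. q j * c j i) + t * c m i" for q t
    by (rule disjI1, rule exI[of _ "q(m := t)"]) (use that in \<open>simp add: sum.lessThan_Suc\<close>)
  show ?case
  proof (cases "\<exists>q. \<forall>i<n. v i = (\<Sum>j<m. q j * c j i)")
    case True
    then obtain q where "\<forall>i<n. v i = (\<Sum>j<m. q j * c j i)" by blast
    then show ?thesis using ext[of q 0] by simp
  next
    case False
    then obtain p where p: "\<forall>j<m. (\<Sum>i<n. c j i * p i) = 0" "(\<Sum>i<n. v i * p i) = 1"
      using Suc.IH[of v] by blast
    define s where "s = (\<Sum>i<n. c m i * p i)"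
    show ?thesis
    proof (cases "s = 0")
      case True
      then show ?thesis using p by (intro disjI2 exI[of _ p]) (auto simp: s_def less_Suc_eq)
    next
      case s: False
      \<comment> \<open>Chosen so that \<open>p\<close> vanishes on \<open>v'\<close>.\<close>
      define v' where "v' i = v i - c m i / s" for i
      show ?thesis
      proof (cases "\<exists>q. \<forall>i<n. v' i = (\<Sum>j<m. q j * c j i)")
        case True
        then obtain q where q: "\<forall>i<n. v' i = (\<Sum>j<m. q j * c j i)" by blast
        have "\<forall>i<n. v i = (\<Sum>j<m. q j * c j i) + (1 / s) * c m i"
          using q by (simp add: v'_def flip: q[rule_format])
        then show ?thesis by (rule ext)
      next
        case False
        then obtain p' where p': "\<forall>j<m. (\<Sum>i<n. c j i * p' i) = 0" "(\<Sum>i<n. v' i * p' i) = 1"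
          using Suc.IH[of v'] by blast
        define e where "e = (\<Sum>i<n. c m i * p' i)"
        \<comment> \<open>The multiple of \<open>p\<close> is chosen to kill the new row; the old
          rows are killed by both terms.\<close>
        define p2 where "p2 i = p' i - e / s * p i" for i
        have lin: "(\<Sum>i<n. f i * p2 i) = (\<Sum>i<n. f i * p' i) - e / s * (\<Sum>i<n. f i * p i)" for f
          by (simp add: p2_def algebra_simps sum_subtractf sum_distrib_left)
        have "(\<Sum>i<n. v' i * p' i) = (\<Sum>i<n. v i * p' i) - e / s"
          by (simp add: v'_def e_def algebra_simps sum_subtractf sum_divide_distrib)
        then have "(\<Sum>i<n. v i * p2 i) = 1" using p(2) p'(2) by (simp add: lin)
        moreover have "\<forall>j<Suc m. (\<Sum>i<n. c j i * p2 i) = 0"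
          using p(1) p'(1) s by (auto simp: lin less_Suc_eq simp flip: e_def s_def)
        ultimately show ?thesis by blast
      qed
    qed
  qed
qed

text \<open>Forward substitution: if each \<open>b i\<close> has order exactly \<open>i\<close>,
  these are the coefficients of the expansion of \<open>h\<close> in the \<open>b i\<close>.\<close>

fun triangular_coeff :: "(nat \<Rightarrow> 'k::field fps) \<Rightarrow> 'k fps \<Rightarrow> nat \<Rightarrow> 'k" where
  "triangular_coeff b h d = (h $ d - (\<Sum>i<d. triangular_coeff b h i * b i $ d)) / b d $ d"

declare triangular_coeff.simps [simp del]

lemma triangular_coeff_sum:
  assumes "b d $ d \<noteq> 0"
  shows "h $ d = (\<Sum>i<Suc d. triangular_coeff b h i * b i $ d)"
  using assms by (simp add: triangular_coeff.simps[of b h d])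

lemma fps_to_fls_sum: "fps_to_fls (\<Sum>i\<in>A. f i) = (\<Sum>i\<in>A. fps_to_fls (f i))"
  by (induction A rule: infinite_finite_induct) simp_all

lemma common_X_power:
  fixes q :: "nat \<Rightarrow> 'k::field fls"
  shows "\<exists>M h. \<forall>i<n. fls_X ^ M * q i = fps_to_fls (h i)"
proof (induction n)
  case (Suc n)
  then obtain M h where h: "\<forall>i<n. fls_X ^ M * q i = fps_to_fls (h i)" by blast
  obtain M' h' where h': "fls_X ^ M' * q n = fps_to_fls h'" by (rule fls_times_X_power_fps)
  define H where "H i = (if i < n then fps_X ^ M' * h i else fps_X ^ M * h')" for i
  have "fls_X ^ (M + M') * q i = fps_to_fls (H i)" if "i < Suc n" for i
  proof (cases "i < n")
    case True
    have "fls_X ^ (M + M') * q i = fls_X ^ M' * (fls_X ^ M * q i)"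
      by (simp add: power_add ac_simps)
    then show ?thesis using True h by (simp add: H_def fls_times_fps_to_fls fps_to_fls_power)
  next
    case False
    then have "fls_X ^ (M + M') * q i = fls_X ^ M * (fls_X ^ M' * q n)"
      using that by (simp add: power_add ac_simps less_Suc_eq)
    then show ?thesis using False h' by (simp add: H_def fls_times_fps_to_fls fps_to_fls_power)
  qed
  then show ?case by blast
qed simp

section \<open>The ring R inside \<open>k[[t]]\<close> and its maximal ideal\<close>

context fps_point
begin

abbreviation R0 :: "'k fps set" where "R0 \<equiv> ev n x ` PS n"

lemma R0_add: "g \<in> R0 \<Longrightarrow> h \<in> R0 \<Longrightarrow> g + h \<in> R0"
  by (auto simp flip: ev_add intro: PS_add)

lemma R0_mult: "g \<in> R0 \<Longrightarrow> h \<in> R0 \<Longrightarrow> g * h \<in> R0"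
  by (auto simp flip: ev_mult intro: PS_mult)

lemma R0_const: "fps_const c \<in> R0"
  by (metis ev_const PS_const imageI)

lemma R0_uminus: "g \<in> R0 \<Longrightarrow> - g \<in> R0"
  by (auto simp flip: ev_uminus intro: PS_uminus)

lemma R0_power: "g \<in> R0 \<Longrightarrow> g ^ k \<in> R0"
  by (induction k) (auto intro: R0_mult simp: R0_const[of 1, simplified])

lemma R0_sum: "(\<And>i. i \<in> A \<Longrightarrow> f i \<in> R0) \<Longrightarrow> (\<Sum>i\<in>A. f i) \<in> R0"
  by (induction A rule: infinite_finite_induct) (auto intro: R0_add simp: R0_const[of 0, simplified])

lemma R0_var: "i < n \<Longrightarrow> x i \<in> R0"
  by (metis ev_var PS_var imageI)

lemma power_series_subring_eq: "power_series_subring n x = fps_to_fls ` R0"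
  unfolding power_series_subring_def image_image by (rule image_cong[OF refl mps_eval_eq_ev])

lemma max_ideal_subset:
  assumes "q \<in> max_ideal (fls_subring (fps_to_fls ` R0))"
  obtains G where "G \<in> PS n" "G 0 = 0" "q = fps_to_fls (ev n x G)"
proof -
  obtain G where G: "G \<in> PS n" "q = fps_to_fls (ev n x G)"
    using assms by (auto simp: max_ideal_def fls_subring_simps)
  have "G 0 = 0"
  proof (rule ccontr)
    assume "G 0 \<noteq> 0"
    then obtain H where H: "H \<in> PS n" "mps_mult G H = mps_const 1" using mps_inverse[OF G(1)] by blast
    have "ev n x G * ev n x H = 1" by (simp add: H(2) ev_const flip: ev_mult)
    then have e: "q * fps_to_fls (ev n x H) = 1" by (simp add: G(2) flip: fls_times_fps_to_fls)
    have "q \<in> Units (fls_subring (fps_to_fls ` R0))"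
      unfolding Units_def fls_subring_simps
    proof (intro CollectI conjI bexI)
      show "fps_to_fls (ev n x H) \<in> fps_to_fls ` R0" using H(1) by blast
      show "q \<in> fps_to_fls ` R0" using G by blast
    qed (use e in \<open>simp_all add: mult.commute\<close>)
    then show False using assms by (simp add: max_ideal_def)
  qed
  then show thesis using that G by blast
qed

text \<open>The form in which the hypothesis on the conductor is used: its elements are values of
  series without constant and linear terms.\<close>

lemma max_ideal_square_subset:
  assumes "q \<in> ideal_prod (fls_subring (fps_to_fls ` R0))
    (max_ideal (fls_subring (fps_to_fls ` R0))) (max_ideal (fls_subring (fps_to_fls ` R0)))"
  shows "\<exists>G\<in>PS n. G 0 = 0 \<and> (\<forall>i. G (unit_exp i) = 0) \<and> q = fps_to_fls (ev n x G)"
  using assms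
proof (induction rule: ideal_prod.induct)
  case (prod q r)
  obtain G where G: "G \<in> PS n" "G 0 = 0" "q = fps_to_fls (ev n x G)" by (rule max_ideal_subset[OF prod(1)])
  obtain H where H: "H \<in> PS n" "H 0 = 0" "r = fps_to_fls (ev n x H)" by (rule max_ideal_subset[OF prod(2)])
  show ?case
    by (rule bexI[of _ "mps_mult G H"])
       (use G H in \<open>simp_all add: PS_mult mps_mult_nth_0 mps_mult_nth_unit ev_mult fls_times_fps_to_fls fls_subring_simps del: One_nat_def\<close>)
next
  case (sum q r)
  then obtain G H where GH: "G \<in> PS n" "G 0 = 0" "\<forall>i. G (unit_exp i) = 0" "q = fps_to_fls (ev n x G)"
    "H \<in> PS n" "H 0 = 0" "\<forall>i. H (unit_exp i) = 0" "r = fps_to_fls (ev n x H)" by blast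
  have "q \<oplus>\<^bsub>fls_subring (fps_to_fls ` R0)\<^esub> r = fps_to_fls (ev n x (G + H))"
    by (simp add: GH ev_add fls_subring_simps)
  moreover have "(G + H) 0 = 0" "\<And>i. (G + H) (unit_exp i) = 0" "G + H \<in> PS n"
    using GH PS_add[OF GH(1,5)] by (simp_all del: One_nat_def)
  ultimately show ?case by blast
qed

end

lemma ideal_vars_subset:
  assumes "F \<in> genideal (mps_ring n) (mps_var ` {..<n} :: 'k::comm_ring_1 mps set)"
  shows "F 0 = 0"
proof -
  interpret cring "mps_ring n :: 'k mps ring" by (rule cring_mps_ring)
  have "genideal (mps_ring n) (mps_var ` {..<n}) \<subseteq> {F \<in> PS n. F 0 = (0 :: 'k)}"
    by (rule genideal_minimal, rule ideal_mpsI)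
       (auto simp: PS_0 PS_add PS_mult PS_var mps_var_nth_0 mps_mult_nth_0)
  then show ?thesis using assms by blast
qed

lemma ideal_vars_square_subset:
  assumes "F \<in> ideal_prod (mps_ring n) (genideal (mps_ring n) (mps_var ` {..<n}))
    (genideal (mps_ring n) (mps_var ` {..<n} :: 'k::comm_ring_1 mps set))"
  shows "F 0 = 0 \<and> (\<forall>i. F (unit_exp i) = 0)"
  using assms
  by (induction rule: ideal_prod.induct)
     (simp_all add: ideal_vars_subset mps_ring_simps mps_mult_nth_0 mps_mult_nth_unit del: One_nat_def)

text \<open>The series \<open>t\<^sup>j x\<^sub>0\<^sup>q\<close>, \<open>j < a\<close>, have the orders \<open>qa + j\<close>, so every power series is a
  combination of \<open>1, t, \<dots>, t\<^bsup>a-1\<^esup>\<close> over \<open>k[[x\<^sub>0]]\<close>; this bounds the denominators.\<close>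

lemma (in fps_point) conductor_nonzero:
  assumes n: "0 < n" and a: "0 < a" and x0: "x 0 = \<alpha> * fps_X ^ a" and \<alpha>: "\<alpha> $ 0 \<noteq> 0"
    and g: "g \<in> R0" "g \<noteq> 0" "g * fps_X \<in> R0"
  obtains N where "\<And>h. fps_X ^ N * h \<in> R0"
proof -
  define b where "b i = fps_X ^ (i mod a) * x 0 ^ (i div a)" for i
  have b: "b i = fps_X ^ i * \<alpha> ^ (i div a)" for i
  proof -
    have "b i = fps_X ^ (i mod a) * (\<alpha> ^ (i div a) * fps_X ^ (a * (i div a)))"
      by (simp only: b_def x0 power_mult_distrib power_mult)
    also have "\<dots> = fps_X ^ (i mod a + a * (i div a)) * \<alpha> ^ (i div a)"
      by (simp only: power_add ac_simps)
    finally show ?thesis by (simp only: mod_mult_div_eq)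
  qed
  have bdd: "b i $ i \<noteq> 0" for i using \<alpha> by (simp add: b fps_X_power_mult_nth fps_nth_power_0)
  have bid: "b i $ d = 0" if "d < i" for i d using that by (simp add: b fps_X_power_mult_nth)
  \<comment> \<open>\<open>U A\<close> is \<open>A\<close> read as a series in the variable
    \<open>X_0\<close> alone; its value is \<open>A(x_0)\<close>.\<close>
  define U :: "'k fps \<Rightarrow> 'k mps" where
    "U A = (\<lambda>u. if Poly_Mapping.keys u \<subseteq> {0} then A $ Poly_Mapping.lookup u 0 else 0)" for A
  have UPS: "U A \<in> PS n" for A using n by (auto simp: PS_iff U_def split: if_splits)
  have me: "monom_eval n x (Poly_Mapping.single 0 q) = x 0 ^ q" for q
  proof -
    have "monom_eval n x (Poly_Mapping.single 0 q) = (\<Prod>j<n. if j = 0 then x 0 ^ q else 1)"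
      unfolding monom_eval_def by (rule prod.cong) (auto simp: lookup_single when_def)
    then show ?thesis using n by simp
  qed
  have evU: "ev n x (U A) $ d = (\<Sum>q\<le>K. A $ q * (x 0 ^ q) $ d)" if "d \<le> K" for A d K
  proof -
    have single: "Poly_Mapping.single 0 (Poly_Mapping.lookup u 0) = u" if "Poly_Mapping.keys u \<subseteq> {0}" for u :: "nat \<Rightarrow>\<^sub>0 nat"
      using that by (intro poly_mapping_eqI) (auto simp: lookup_single when_def in_keys_iff subset_iff)
    have deg: "exp_deg n (Poly_Mapping.single 0 q) = q" for q
      using n by (simp add: exp_weight_def lookup_single when_def)
    have "ev n x (U A) $ d = (\<Sum>u\<in>exps n K. U A u * monom_eval n x u $ d)" by (rule ev_nth[OF that])
    also have "\<dots> = (\<Sum>u\<in>{u \<in> exps n K. Poly_Mapping.keys u \<subseteq> {0}}. U A u * monom_eval n x u $ d)"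
      by (rule sum.mono_neutral_right) (auto simp: finite_exps U_def)
    also have "\<dots> = (\<Sum>q\<le>K. A $ q * (x 0 ^ q) $ d)"
    proof (rule sum.reindex_bij_witness[of _ "Poly_Mapping.single 0" "\<lambda>u. Poly_Mapping.lookup u 0"])
      fix q assume "q \<in> {..K}"
      then show "Poly_Mapping.single 0 q \<in> {u \<in> exps n K. Poly_Mapping.keys u \<subseteq> {0}}"
        using n deg[of q] by (auto simp: exps_iff split: if_splits)
    next
      fix u assume u: "u \<in> {u \<in> exps n K. Poly_Mapping.keys u \<subseteq> {0}}"
      show "Poly_Mapping.single 0 (Poly_Mapping.lookup u 0) = u" using u single by blast
      then show "Poly_Mapping.lookup u 0 \<in> {..K}"
        using u deg[of "Poly_Mapping.lookup u 0"] by (simp add: exps_iff)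
      show "A $ Poly_Mapping.lookup u 0 * (x 0 ^ Poly_Mapping.lookup u 0) $ d = U A u * monom_eval n x u $ d"
        using u me[of "Poly_Mapping.lookup u 0"] single[of u] by (simp add: U_def)
    qed simp
    finally show ?thesis .
  qed
  have gen: "\<exists>H. (\<forall>j<a. H j \<in> R0) \<and> h = (\<Sum>j<a. fps_X ^ j * H j)" for h
  proof -
    define c where "c = triangular_coeff b h"
    define H where "H j = ev n x (U (Abs_fps (\<lambda>q. c (q * a + j))))" for j
    have "h $ d = (\<Sum>j<a. fps_X ^ j * H j) $ d" for d
    proof -
      have "h $ d = (\<Sum>i<Suc d. c i * b i $ d)"
        unfolding c_def by (rule triangular_coeff_sum[OF bdd])
      \<comment> \<open>The range is extended to a multiple of \<open>a\<close>, so that indices can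
        be grouped by quotient and remainder; the added \<open>b i\<close> have order above
        \<open>d\<close>.\<close>
      also have "\<dots> = (\<Sum>i<Suc d * a. c i * b i $ d)"
      proof (rule sum.mono_neutral_left)
        have "Suc d \<le> Suc d * a" using a by (cases a) auto
        then show "{..<Suc d} \<subseteq> {..<Suc d * a}" by auto
      qed (auto simp: bid)
      also have "\<dots> = (\<Sum>q<Suc d. \<Sum>i\<in>{q * a..<q * a + a}. c i * b i $ d)"
        by (rule sum.nat_group[symmetric])
      also have "\<dots> = (\<Sum>q<Suc d. \<Sum>j<a. c (q * a + j) * (fps_X ^ j * x 0 ^ q) $ d)"
      proof (rule sum.cong[OF refl])
        fix q
        have "b (q * a + j) = fps_X ^ j * x 0 ^ q" if "j < a" for j
          using that a by (simp add: b_def)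
        moreover have "(\<Sum>i\<in>{q * a..<q * a + a}. c i * b i $ d) = (\<Sum>j<a. c (q * a + j) * b (q * a + j) $ d)"
          by (rule sum.reindex_bij_witness[of _ "\<lambda>j. q * a + j" "\<lambda>i. i - q * a"]) auto
        ultimately show "(\<Sum>i\<in>{q * a..<q * a + a}. c i * b i $ d) = (\<Sum>j<a. c (q * a + j) * (fps_X ^ j * x 0 ^ q) $ d)"
          by simp
      qed
      also have "\<dots> = (\<Sum>j<a. \<Sum>q<Suc d. c (q * a + j) * (fps_X ^ j * x 0 ^ q) $ d)"
        by (rule sum.swap)
      also have "\<dots> = (\<Sum>j<a. (fps_X ^ j * H j) $ d)"
      proof (rule sum.cong[OF refl])
        fix j
        show "(\<Sum>q<Suc d. c (q * a + j) * (fps_X ^ j * x 0 ^ q) $ d) = (fps_X ^ j * H j) $ d"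
        proof (cases "d < j")
          case False
          then show ?thesis
            by (simp add: fps_X_power_mult_nth H_def evU[of "d - j" d] lessThan_Suc_atMost)
        qed (simp add: fps_X_power_mult_nth)
      qed
      finally show ?thesis by (simp add: fps_sum_nth)
    qed
    then have "h = (\<Sum>j<a. fps_X ^ j * H j)" by (intro fps_ext)
    moreover have "\<forall>j<a. H j \<in> R0" using UPS by (auto simp: H_def)
    ultimately show ?thesis by blast
  qed
  \<comment> \<open>For \<open>j < a\<close> the product \<open>g^(a-1) t^j\<close> equals
    \<open>g^(a-1-j) (g t)^j\<close>, which lies in \<open>R0\<close>. So \<open>g0\<close> clears
    the powers \<open>1, ..., t^(a-1)\<close> simultaneously.\<close>
  define g0 where "g0 = g ^ (a - 1)"
  have g0: "g0 * h \<in> R0" for h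
  proof -
    obtain H where H: "\<forall>j<a. H j \<in> R0" "h = (\<Sum>j<a. fps_X ^ j * H j)" using gen by blast
    have "g0 * h = (\<Sum>j<a. g ^ (a - 1 - j) * (g * fps_X) ^ j * H j)"
    proof -
      have "g0 * (fps_X ^ j * H j) = g ^ (a - 1 - j) * (g * fps_X) ^ j * H j" if "j < a" for j
      proof -
        have "g0 = g ^ (a - 1 - j) * g ^ j" using that by (simp add: g0_def flip: power_add)
        then show ?thesis by (simp add: power_mult_distrib ac_simps)
      qed
      then show ?thesis unfolding H(2) sum_distrib_left by (intro sum.cong) auto
    qed
    also have "\<dots> \<in> R0" 
      using H(1) R0_mult[OF R0_mult[OF R0_power[OF g(1)] R0_power[OF g(3)]]] by (intro R0_sum) auto
    finally show ?thesis .
  qed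
  \<comment> \<open>Up to a unit of \<open>k[[t]]\<close>, \<open>g0\<close> is a power of
    \<open>t\<close>; that power inherits the property of \<open>g0\<close>.\<close>
  have "g0 dvd fps_X ^ subdegree g0" using g(2) by (simp add: g0_def fps_dvd_iff)
  then obtain e where e: "fps_X ^ subdegree g0 = g0 * e" by (rule dvdE)
  have "fps_X ^ subdegree g0 * h \<in> R0" for h
    unfolding e mult.assoc by (rule g0)
  then show thesis using that by blast
qed

section \<open>Torsion in the module of differentials\<close>

context fps_point
begin

lemma ev_nth_0: "ev n x F $ 0 = F 0"
proof -
  have "exps n 0 \<subseteq> {0}" using exp_deg_eq_0 by (auto simp: exps_iff simp del: One_nat_def)
  moreover have "0 \<in> exps n 0" by (simp add: exps_iff exp_weight_0)
  ultimately have "exps n 0 = {0}" by blast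
  then show ?thesis by (simp add: ev_def monom_eval_def)
qed

text \<open>A linear form that vanishes on the columns of the Jacobian matrix induces a derivation
  \<open>R \<rightarrow> k((t))\<close>, which is \<open>\<epsilon> d/dt\<close>; hence the form is a multiple of \<open>(x\<^sub>1', \<dots>, x\<^sub>n')\<close>.\<close>

lemma jacobian_span:
  fixes m :: nat
  assumes mem: "\<And>h. fps_X ^ N * h \<in> R0"
    and I: "I = {F \<in> PS n. ev n x F = 0}"
    and f: "\<And>j. j < m \<Longrightarrow> f j \<in> PS n" "I = genideal (mps_ring n) (f ` {..<m})"
    and v: "(\<Sum>i<n. v i * fps_deriv (x i)) = 0"
  obtains r W where "r \<in> R0" "r \<noteq> 0" "\<And>j. j < m \<Longrightarrow> W j \<in> R0"
    "\<And>i. i < n \<Longrightarrow> r * v i = (\<Sum>j<m. ev n x (mps_deriv i (f j)) * W j)"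
proof -
  interpret cring "mps_ring n :: 'k mps ring" by (rule cring_mps_ring)
  define c where "c j i = fps_to_fls (ev n x (mps_deriv i (f j)))" for j i
  have fI: "f j \<in> I" if "j < m" for j
    using genideal_self[of "f ` {..<m}"] f that by auto
  have "\<not> ((\<forall>j<m. (\<Sum>i<n. c j i * p i) = 0) \<and> (\<Sum>i<n. fps_to_fls (v i) * p i) = 1)" for p
  proof
    assume p: "(\<forall>j<m. (\<Sum>i<n. c j i * p i) = 0) \<and> (\<Sum>i<n. fps_to_fls (v i) * p i) = 1"
    define \<delta> where "\<delta> G = (\<Sum>i<n. fps_to_fls (ev n x (mps_deriv i G)) * p i)" for G
    have \<delta>_add: "\<delta> (F + G) = \<delta> F + \<delta> G" for F G
      by (simp add: \<delta>_def mps_deriv_add ev_add algebra_simps sum.distrib del: plus_fun_apply)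
    have \<delta>_0: "\<delta> 0 = 0"
      by (simp add: \<delta>_def mps_deriv_0 ev_0)
    have \<delta>_mult: "\<delta> (mps_mult F G) = fps_to_fls (ev n x F) * \<delta> G + fps_to_fls (ev n x G) * \<delta> F" for F G
      by (simp add: \<delta>_def mps_deriv_mult ev_add ev_mult fls_times_fps_to_fls algebra_simps
          sum.distrib sum_distrib_left del: plus_fun_apply)
    have \<delta>_const: "\<delta> (mps_const a) = 0" for a
      by (simp add: \<delta>_def mps_deriv_const ev_0)
    \<comment> \<open>Elements of \<open>I\<close> have value 0, so on \<open>I\<close> the product
      rule turns into linearity.\<close>
    have "ideal {F \<in> I. \<delta> F = 0} (mps_ring n)"
      by (rule ideal_mpsI)
         (simp_all add: I \<delta>_0 \<delta>_add \<delta>_mult PS_add PS_mult PS_0 ev_0 ev_add ev_mult subset_iff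
           del: plus_fun_apply zero_fun_apply)
    moreover have "f ` {..<m} \<subseteq> {F \<in> I. \<delta> F = 0}"
      using p fI by (auto simp: \<delta>_def c_def)
    ultimately have "genideal (mps_ring n) (f ` {..<m}) \<subseteq> {F \<in> I. \<delta> F = 0}"
      by (rule genideal_minimal)
    then have \<delta>_I: "\<delta> F = 0" if "F \<in> PS n" "ev n x F = 0" for F
      using that f(2) I by blast
    define lift where "lift g = (SOME G. G \<in> PS n \<and> ev n x G = g)" for g
    have lift: "lift g \<in> PS n" "ev n x (lift g) = g" if g: "g \<in> R0" for g
    proof -
      have "\<exists>G. G \<in> PS n \<and> ev n x G = g" using g by blast
      from someI_ex[OF this] show "lift g \<in> PS n" "ev n x (lift g) = g"
        by (simp_all add: lift_def)
    qed
    define D where "D g = \<delta> (lift g)" for g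
    have D: "D (ev n x G) = \<delta> G" if G: "G \<in> PS n" for G
    proof -
      have e: "ev n x G \<in> R0" using G by blast
      have "\<delta> (lift (ev n x G) - G) = 0"
        by (rule \<delta>_I) (use lift[OF e] G in \<open>simp_all add: PS_diff ev_diff\<close>)
      then show ?thesis using \<delta>_add[of "lift (ev n x G) - G" G] by (simp add: D_def)
    qed
    obtain M p' where M: "\<forall>i<n. fls_X ^ M * p i = fps_to_fls (p' i)"
      using common_X_power[of n p] by blast
    obtain \<epsilon> where \<epsilon>: "\<And>g. g \<in> R0 \<Longrightarrow> D g = \<epsilon> * fps_to_fls (fps_deriv g)"
    proof (rule bounded_derivation_subring[of N R0 D M])
      show "fps_X ^ N * h \<in> R0" for h by (rule mem)
    next
      fix g h assume "g \<in> R0" "h \<in> R0"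
      then obtain G H where GH: "G \<in> PS n" "g = ev n x G" "H \<in> PS n" "h = ev n x H" by blast
      show "D (g + h) = D g + D h"
        using D[OF PS_add[OF GH(1,3)]] by (simp add: GH D ev_add \<delta>_add del: plus_fun_apply)
      show "D (g * h) = fps_to_fls g * D h + fps_to_fls h * D g"
        using D[OF PS_mult[OF GH(1,3)]] by (simp add: GH D ev_mult \<delta>_mult)
    next
      fix a g assume "g \<in> R0"
      then obtain G where G: "G \<in> PS n" "g = ev n x G" by blast
      show "D (fps_const a * g) = fls_const a * D g"
        using D[OF PS_mult[OF PS_const G(1)], of a] by (simp add: G D ev_mult \<delta>_mult \<delta>_const ev_const)
    next
      fix g assume "g \<in> R0"
      then obtain G where G: "G \<in> PS n" "g = ev n x G" by blast
      have "fls_X ^ M * D g = (\<Sum>i<n. fps_to_fls (ev n x (mps_deriv i G)) * (fls_X ^ M * p i))"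
        by (simp add: G D \<delta>_def sum_distrib_left ac_simps)
      also have "\<dots> = (\<Sum>i<n. fps_to_fls (ev n x (mps_deriv i G) * p' i))"
        by (rule sum.cong) (simp_all add: M fls_times_fps_to_fls)
      also have "\<dots> = fps_to_fls (\<Sum>i<n. ev n x (mps_deriv i G) * p' i)"
        by (simp add: fps_to_fls_sum)
      finally show "\<exists>h. fls_X ^ M * D g = fps_to_fls h" by blast
    next
      fix \<epsilon> assume a: "\<And>g. g \<in> R0 \<Longrightarrow> D g = \<epsilon> * fps_to_fls (fps_deriv g)"
      show thesis by (rule that[OF a])
    qed
    have px: "p i = \<epsilon> * fps_to_fls (fps_deriv (x i))" if i: "i < n" for i
    proof -
      have "\<delta> (mps_var i) = (\<Sum>j<n. if j = i then p i else 0)"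
        unfolding \<delta>_def by (rule sum.cong) (auto simp: mps_deriv_var ev_const)
      then have "\<delta> (mps_var i) = p i" using i by simp
      then show ?thesis using \<epsilon>[OF R0_var[OF i]] D[OF PS_var[OF i]] by (simp add: ev_var[OF i])
    qed
    have "(\<Sum>i<n. fps_to_fls (v i) * p i) = (\<Sum>i<n. \<epsilon> * fps_to_fls (v i * fps_deriv (x i)))"
      by (rule sum.cong) (simp_all add: px fls_times_fps_to_fls)
    also have "\<dots> = \<epsilon> * fps_to_fls (\<Sum>i<n. v i * fps_deriv (x i))"
      by (simp add: fps_to_fls_sum sum_distrib_left)
    finally show False using p v by simp
  qed
  then obtain q where q: "\<forall>i<n. fps_to_fls (v i) = (\<Sum>j<m. q j * c j i)"
    using span_or_functional[of n "\<lambda>i. fps_to_fls (v i)" c m] by blast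
  obtain M h where M: "\<forall>j<m. fls_X ^ M * q j = fps_to_fls (h j)"
    using common_X_power[of m q] by blast
  \<comment> \<open>\<open>t^M\<close> clears the denominators of the coefficients
    \<open>q j\<close>, and \<open>t^N\<close> then moves the resulting power series into
    \<open>R0\<close>.\<close>
  show thesis
  proof
    show "fps_X ^ N * fps_X ^ M \<in> R0" "fps_X ^ N * fps_X ^ M \<noteq> (0 :: 'k fps)"
      using mem by auto
    show "fps_X ^ N * h j \<in> R0" for j by (rule mem)
    fix i assume i: "i < n"
    have "fps_to_fls (fps_X ^ N * fps_X ^ M * v i) = (\<Sum>j<m. fls_X ^ N * (fls_X ^ M * q j) * c j i)"
      using q i by (simp add: fls_times_fps_to_fls fps_to_fls_power sum_distrib_left ac_simps)
    also have "\<dots> = (\<Sum>j<m. fps_to_fls (ev n x (mps_deriv i (f j)) * (fps_X ^ N * h j)))"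
    proof (rule sum.cong[OF refl])
      fix j assume "j \<in> {..<m}"
      then have "fls_X ^ M * q j = fps_to_fls (h j)" using M by simp
      then show "fls_X ^ N * (fls_X ^ M * q j) * c j i = fps_to_fls (ev n x (mps_deriv i (f j)) * (fps_X ^ N * h j))"
        by (simp only: c_def fls_times_fps_to_fls fps_to_fls_power fps_X_to_fls mult_ac)
    qed
    also have "\<dots> = fps_to_fls (\<Sum>j<m. ev n x (mps_deriv i (f j)) * (fps_X ^ N * h j))"
      by (simp add: fps_to_fls_sum)
    finally show "fps_X ^ N * fps_X ^ M * v i = (\<Sum>j<m. ev n x (mps_deriv i (f j)) * (fps_X ^ N * h j))"
      by (simp only: fps_to_fls_eq_iff)
  qed
qed

text \<open>A relation \<open>\<Sum> V\<^sub>i dx\<^sub>i = 0\<close> in a torsion-free module of differentials lifts to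
  \<open>\<Sum> V\<^sub>i dX\<^sub>i = \<Sum> W\<^sub>j df\<^sub>j\<close> modulo \<open>I\<close>, and \<open>d(\<Sum> W\<^sub>j df\<^sub>j)\<close> vanishes at the origin.\<close>

lemma relation_curl_free:
  fixes m :: nat
  assumes I: "\<And>F. F \<in> PS n \<Longrightarrow> ev n x F = 0 \<Longrightarrow> F 0 = 0 \<and> (\<forall>i. F (unit_exp i) = 0)"
    and f: "\<And>j. j < m \<Longrightarrow> f j \<in> PS n" "\<And>j. j < m \<Longrightarrow> ev n x (f j) = 0"
    and torsion_free: "\<And>v. (\<And>i. i < n \<Longrightarrow> v i \<in> R0) \<Longrightarrow> (\<Sum>i<n. v i * fps_deriv (x i)) = 0 \<Longrightarrow>
      \<exists>W. (\<forall>j<m. W j \<in> R0) \<and> (\<forall>i<n. v i = (\<Sum>j<m. ev n x (mps_deriv i (f j)) * W j))"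
    and V: "\<And>i. i < n \<Longrightarrow> V i \<in> PS n" "(\<Sum>i<n. ev n x (V i) * fps_deriv (x i)) = 0"
    and il: "i < n" "l < n"
  shows "V i (unit_exp l) = V l (unit_exp i)"
proof -
  obtain W where W: "\<forall>j<m. W j \<in> R0"
    "\<forall>i<n. ev n x (V i) = (\<Sum>j<m. ev n x (mps_deriv i (f j)) * W j)"
    using torsion_free[of "\<lambda>i. ev n x (V i)"] V by blast
  have "\<forall>j. \<exists>G. j < m \<longrightarrow> G \<in> PS n \<and> W j = ev n x G" using W(1) by blast
  then obtain G where G: "\<And>j. j < m \<Longrightarrow> G j \<in> PS n \<and> W j = ev n x (G j)" by metis
  \<comment> \<open>As the \<open>f j\<close> have no linear terms, only the constant terms of the
    \<open>G j\<close> matter: the right-hand side is the Hessian at the origin of the sum of the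
    \<open>G j 0 f j\<close>, hence symmetric.\<close>
  have *: "V i (unit_exp l) = (\<Sum>j<m. of_nat (if i = l then 2 else 1) * f j (unit_exp i + unit_exp l) * G j 0)"
    if "i < n" for i l
  proof -
    define K where "K = V i - (\<Sum>j<m. mps_mult (mps_deriv i (f j)) (G j))"
    have "K \<in> PS n" unfolding K_def by (intro PS_diff PS_sum PS_mult PS_deriv V(1) that) (use f G in auto)
    moreover have "ev n x K = 0"
      using W(2) that G by (simp add: K_def ev_diff ev_sum ev_mult)
    ultimately have "K (unit_exp l) = 0" using I by blast
    then have "V i (unit_exp l) = (\<Sum>j<m. mps_mult (mps_deriv i (f j)) (G j) (unit_exp l))"
      by (simp add: K_def sum_fun_apply del: One_nat_def)
    also have "\<dots> = (\<Sum>j<m. of_nat (if i = l then 2 else 1) * f j (unit_exp i + unit_exp l) * G j 0)"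
      using I f
      by (intro sum.cong) (simp_all add: mps_mult_nth_unit mps_deriv_unit_exp mps_deriv_0_nth del: One_nat_def)
    finally show ?thesis .
  qed
  show ?thesis
    unfolding *[OF il(1), of l] *[OF il(2), of i] by (simp add: add.commute eq_commute[of i l])
qed

end

text \<open>The coset of \<open>v\<close> is killed by \<open>r\<close>, hence torsion, hence the
  zero coset. The work is that the image of \<open>J\<close> is a submodule, so that cosets of its
  elements collapse to it.\<close>

lemma torsion_free_cokernel:
  fixes A :: "'k::field fls set" and J :: "'k fls mat"
  assumes A: "\<And>p q. p \<in> A \<Longrightarrow> q \<in> A \<Longrightarrow> p + q \<in> A" "\<And>p q. p \<in> A \<Longrightarrow> q \<in> A \<Longrightarrow> p * q \<in> A"
      "0 \<in> A" "- 1 \<in> A"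
    and J: "J \<in> carrier_mat n m"
    and N: "N = mult_mat_vec J ` carrier (free_module A m)"
    and torsion: "torsion_submodule (fls_subring A) (quotient_module (free_module A n) N) =
      {\<zero>\<^bsub>quotient_module (free_module A n) N\<^esub>}"
    and v: "v \<in> carrier (free_module A n)" and r: "r \<in> A" "r \<noteq> 0" "r \<cdot>\<^sub>v v \<in> N"
  shows "v \<in> N"
proof -
  have car: "w \<in> carrier (free_module A k) \<longleftrightarrow> w \<in> carrier_vec k \<and> (\<forall>i<k. vec_index w i \<in> A)" for w k
    by (simp add: free_module_def)
  have free_add: "ring.add (free_module A n) = (+)" and free_smult: "module.smult (free_module A n) = (\<cdot>\<^sub>v)"
    by (simp_all add: free_module_def module_vec_simps)
  have Ncar: "b \<in> carrier_vec n" if "b \<in> N" for b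
    using that mult_mat_vec_carrier[OF J] by (auto simp: N car)
  have Nadd: "b + b' \<in> N" if bN: "b \<in> N" "b' \<in> N" for b b'
  proof -
    obtain w w' where w: "w \<in> carrier (free_module A m)" "b = J *\<^sub>v w"
      "w' \<in> carrier (free_module A m)" "b' = J *\<^sub>v w'"
      using bN unfolding N by blast
    then have "b + b' = J *\<^sub>v (w + w')" using J by (simp add: car mult_add_distrib_mat_vec)
    moreover have "w + w' \<in> carrier (free_module A m)" using w A(1) by (auto simp: car)
    ultimately show ?thesis by (auto simp: N)
  qed
  have Nsmult: "a \<cdot>\<^sub>v b \<in> N" if bN: "b \<in> N" "a \<in> A" for a b
  proof -
    obtain w where w: "w \<in> carrier (free_module A m)" "b = J *\<^sub>v w"
      using bN unfolding N by blast
    then have "a \<cdot>\<^sub>v b = J *\<^sub>v (a \<cdot>\<^sub>v w)" using J by (simp add: car mult_mat_vec)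
    moreover have "a \<cdot>\<^sub>v w \<in> carrier (free_module A m)" using w A(2) bN(2) by (auto simp: car)
    ultimately show ?thesis by (auto simp: N)
  qed
  have N0: "0\<^sub>v n \<in> N"
  proof -
    have "0\<^sub>v n = J *\<^sub>v 0\<^sub>v m" using J by (auto intro!: eq_vecI)
    moreover have "0\<^sub>v m \<in> carrier (free_module A m)" using A(3) by (auto simp: car)
    ultimately show ?thesis unfolding N by blast
  qed
  have coset: "N +>\<^bsub>free_module A n\<^esub> u = {b + u | b. b \<in> N}" for u
    by (auto simp: a_r_coset_def' free_add)
  have absorb: "N +>\<^bsub>free_module A n\<^esub> u = N" if u: "u \<in> N" for u
  proof
    show "N +>\<^bsub>free_module A n\<^esub> u \<subseteq> N" using Nadd u by (auto simp: coset)
    show "N \<subseteq> N +>\<^bsub>free_module A n\<^esub> u"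
    proof
      fix b assume b: "b \<in> N"
      have "b = (b + (- 1) \<cdot>\<^sub>v u) + u"
        using Ncar[OF b] Ncar[OF u] by (intro eq_vecI) auto
      moreover have "b + (- 1) \<cdot>\<^sub>v u \<in> N" using Nadd[OF b Nsmult[OF u A(4)]] .
      ultimately show "b \<in> N +>\<^bsub>free_module A n\<^esub> u" unfolding coset by blast
    qed
  qed
  let ?Q = "quotient_module (free_module A n) N"
  let ?U = "N +>\<^bsub>free_module A n\<^esub> v"
  have vc: "v \<in> carrier_vec n" using v by (simp add: car)
  have inU: "v \<in> ?U" unfolding coset using N0 vc by (auto intro!: exI[of _ "0\<^sub>v n"])
  \<comment> \<open>Scalar multiplication of cosets is a union over representatives; each member
    equals \<open>N\<close>, and \<open>inU\<close> guarantees that the union is not empty.\<close>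
  have "r \<odot>\<^bsub>?Q\<^esub> ?U = (\<Union>u\<in>?U. N +>\<^bsub>free_module A n\<^esub> (r \<cdot>\<^sub>v u))"
    by (simp add: quotient_module_def free_smult)
  also have "\<dots> = (\<Union>u\<in>?U. N)"
  proof (intro SUP_cong refl absorb)
    fix u assume "u \<in> ?U"
    then obtain b where b: "b \<in> N" "u = b + v" by (auto simp: coset)
    then have "r \<cdot>\<^sub>v u = r \<cdot>\<^sub>v b + r \<cdot>\<^sub>v v" using smult_add_distrib_vec[OF Ncar[OF b(1)] vc] by simp
    then show "r \<cdot>\<^sub>v u \<in> N" using Nadd[OF Nsmult[OF b(1) r(1)] r(3)] by simp
  qed
  also have "\<dots> = \<zero>\<^bsub>?Q\<^esub>" using inU by (auto simp: quotient_module_def)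
  finally have "r \<odot>\<^bsub>?Q\<^esub> ?U = \<zero>\<^bsub>?Q\<^esub>" .
  moreover have "?U \<in> carrier ?Q"
    using v by (auto simp: quotient_module_def A_RCOSETS_def')
  ultimately have "?U \<in> torsion_submodule (fls_subring A) ?Q"
    using r by (auto simp: torsion_submodule_def fls_subring_simps)
  then have "?U = N" using torsion by (simp add: quotient_module_def)
  then show ?thesis using inU by simp
qed

section \<open>The wedge of two eigenvectors\<close>

lemma fps_X_power_dvd_deriv:
  fixes f :: "'k::field fps"
  assumes "fps_X ^ k dvd f"
  shows "fps_X ^ (k - 1) dvd fps_deriv f"
  using assms by (auto simp: fps_X_power_dvd_iff)

text \<open>Used with orders \<open>a\<close> and \<open>c - a\<close>, which gives
  \<open>c - 1\<close>, one short of the conductor.\<close>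

lemma fps_X_power_dvd_mult_deriv:
  fixes u t :: "'k::field fps"
  assumes "fps_X ^ a dvd u" "fps_X ^ b dvd t" "0 < a" "0 < b"
  shows "fps_X ^ (a + b - 1) dvd u * fps_deriv t" "fps_X ^ (a + b - 1) dvd t * fps_deriv u"
proof -
  have "fps_X ^ a * fps_X ^ (b - 1) dvd u * fps_deriv t" "fps_X ^ b * fps_X ^ (a - 1) dvd t * fps_deriv u"
    using mult_dvd_mono[OF assms(1) fps_X_power_dvd_deriv[OF assms(2)]]
      mult_dvd_mono[OF assms(2) fps_X_power_dvd_deriv[OF assms(1)]] .
  moreover have "a + (b - 1) = a + b - 1" "b + (a - 1) = a + b - 1" using assms(3,4) by auto
  ultimately show "fps_X ^ (a + b - 1) dvd u * fps_deriv t" "fps_X ^ (a + b - 1) dvd t * fps_deriv u"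
    by (simp_all only: power_add[symmetric])
qed

text \<open>Let \<open>p = z + \<tau>\<close>, \<open>q = w + \<sigma>\<close> with eigenvectors \<open>z\<close>, \<open>w\<close> of \<open>\<epsilon> d/dt\<close>, of positive
  eigenvalues \<open>d\<close>, \<open>e\<close>, and with \<open>\<tau>\<close>, \<open>\<sigma>\<close> in \<open>\<CC> / x\<^sub>1\<close>. Then \<open>p dq - (e/d) q dp\<close> is the
  differential of an element of the conductor, hence of the value of some \<open>G\<close> without linear part;
  so \<open>P dQ - (e/d) Q dP - dG\<close> is a relation in the module of differentials.\<close>

lemma eigenvector_wedge:
  fixes x :: "nat \<Rightarrow> 'k::field_char_0 fps"
  assumes point: "fps_point n x"
    and curl: "\<And>V i l. (\<And>i. i < n \<Longrightarrow> V i \<in> PS n) \<Longrightarrow>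
      (\<Sum>i<n. ev n x (V i) * fps_deriv (x i)) = 0 \<Longrightarrow> i < n \<Longrightarrow> l < n \<Longrightarrow>
      V i (unit_exp l) = V l (unit_exp i)"
    and ac: "0 < a" "2 * a \<le> c"
    and cond: "\<And>h. \<exists>G\<in>PS n. G 0 = 0 \<and> (\<forall>i. G (unit_exp i) = 0) \<and> fps_X ^ c * h = ev n x G"
    and P: "P \<in> PS n" "P 0 = 0" "ev n x P = z + \<tau>" "fps_X ^ a dvd z" "fps_X ^ (c - a) dvd \<tau>"
      "\<epsilon> * fps_to_fls (fps_deriv z) = of_nat d * fps_to_fls z" "0 < d"
    and Q: "Q \<in> PS n" "Q 0 = 0" "ev n x Q = w + \<sigma>" "fps_X ^ a dvd w" "fps_X ^ (c - a) dvd \<sigma>"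
      "\<epsilon> * fps_to_fls (fps_deriv w) = of_nat e * fps_to_fls w" "0 < e"
    and il: "i < n" "l < n"
  shows "P (unit_exp i) * Q (unit_exp l) = P (unit_exp l) * Q (unit_exp i)"
proof -
  interpret fps_point n x by (rule point)
  define \<kappa> where "\<kappa> = (of_nat e / of_nat d :: 'k)"
  \<comment> \<open>Multiplied by \<open>\<epsilon>\<close>, both sides become
    \<open>e z w\<close>.\<close>
  have zw: "z * fps_deriv w = fps_const \<kappa> * w * fps_deriv z"
  proof (cases "z = 0 \<or> w = 0")
    case False
    have \<epsilon>: "\<epsilon> \<noteq> 0" using P(6,7) False by auto
    have "\<epsilon> * fps_to_fls (of_nat d * (z * fps_deriv w)) =
        of_nat d * fps_to_fls z * (\<epsilon> * fps_to_fls (fps_deriv w))"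
      by (simp add: fls_times_fps_to_fls ac_simps)
    also have "\<dots> = of_nat e * fps_to_fls w * (\<epsilon> * fps_to_fls (fps_deriv z))"
      by (simp add: P(6) Q(6) ac_simps)
    also have "\<dots> = \<epsilon> * fps_to_fls (of_nat e * (w * fps_deriv z))"
      by (simp add: fls_times_fps_to_fls ac_simps)
    finally have *: "of_nat d * (z * fps_deriv w) = of_nat e * (w * fps_deriv z)"
      using \<epsilon> by (simp only: mult_cancel_left fps_to_fls_eq_iff) simp
    have d: "(of_nat d :: 'k fps) \<noteq> 0" using P(7) by simp
    have "of_nat d * \<kappa> = of_nat e" using P(7) by (simp add: \<kappa>_def)
    then have "of_nat d * fps_const \<kappa> = (of_nat e :: 'k fps)"
      by (simp only: fps_of_nat[symmetric] fps_const_mult)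
    then have "of_nat d * (z * fps_deriv w) = of_nat d * (fps_const \<kappa> * w * fps_deriv z)"
      using * by (simp only: mult.assoc[symmetric])
    then show ?thesis using d by simp
  qed auto
  define p q where "p = ev n x P" and "q = ev n x Q"
  define \<rho> where "\<rho> = p * fps_deriv q - fps_const \<kappa> * (q * fps_deriv p)"
  have aca: "a \<le> c - a" using ac by simp
  have ca: "fps_X ^ a dvd \<tau>" "fps_X ^ a dvd \<sigma>"
    using dvd_trans[OF le_imp_power_dvd[OF aca]] P(5) Q(5) by blast+
  \<comment> \<open>By \<open>zw\<close> the pure eigenvector terms cancel. Each remaining term
    contains an error of order at least \<open>c - a\<close>, and its other factor, or the series
    differentiated there, has order at least \<open>a\<close>.\<close>
  have "\<rho> = z * fps_deriv \<sigma> + \<tau> * fps_deriv w + \<tau> * fps_deriv \<sigma>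
      - fps_const \<kappa> * (w * fps_deriv \<tau> + \<sigma> * fps_deriv z + \<sigma> * fps_deriv \<tau>)"
    unfolding \<rho>_def p_def q_def P(3) Q(3) using zw by (simp add: algebra_simps)
  moreover have e: "a + (c - a) - 1 = c - 1" and c0: "0 < c - a" using ac by auto
  ultimately have "fps_X ^ (c - 1) dvd \<rho>"
    using fps_X_power_dvd_mult_deriv[OF P(4) Q(5) ac(1) c0] fps_X_power_dvd_mult_deriv[OF Q(4) P(5) ac(1) c0]
      fps_X_power_dvd_mult_deriv[OF ca(1) Q(5) ac(1) c0] fps_X_power_dvd_mult_deriv[OF ca(2) P(5) ac(1) c0]
    unfolding e by (auto intro!: dvd_diff dvd_add dvd_mult)
  then have "fps_X ^ c dvd fps_integral \<rho> 0"
    by (auto simp: fps_X_power_dvd_iff fps_integral_def)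
  then obtain h where "fps_integral \<rho> 0 = fps_X ^ c * h" by (rule dvdE)
  then obtain G where G: "G \<in> PS n" "G 0 = 0" "\<forall>i. G (unit_exp i) = 0" "fps_integral \<rho> 0 = ev n x G"
    using cond[of h] by auto
  define V where "V i = mps_mult P (mps_deriv i Q) - mps_mult (mps_const \<kappa>) (mps_mult Q (mps_deriv i P))
      - mps_deriv i G" for i
  have VPS: "V i \<in> PS n" for i
    unfolding V_def by (intro PS_diff PS_mult PS_const PS_deriv P Q G)
  have "(\<Sum>i<n. ev n x (V i) * fps_deriv (x i)) =
      p * (\<Sum>i<n. ev n x (mps_deriv i Q) * fps_deriv (x i))
      - fps_const \<kappa> * (q * (\<Sum>i<n. ev n x (mps_deriv i P) * fps_deriv (x i)))
      - (\<Sum>i<n. ev n x (mps_deriv i G) * fps_deriv (x i))"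
    unfolding V_def ev_diff ev_mult ev_const p_def[symmetric] q_def[symmetric]
    by (simp add: algebra_simps sum_subtractf sum.distrib sum_distrib_left)
  also have "\<dots> = p * fps_deriv q - fps_const \<kappa> * (q * fps_deriv p) - fps_deriv (ev n x G)"
    using P(1) Q(1) G(1) by (simp add: fps_deriv_ev p_def q_def)
  also have "\<dots> = 0" unfolding G(4)[symmetric] fps_deriv_fps_integral by (simp add: \<rho>_def)
  finally have V0: "(\<Sum>i<n. ev n x (V i) * fps_deriv (x i)) = 0" .
  have Vl: "V i (unit_exp l) = P (unit_exp l) * Q (unit_exp i) - \<kappa> * (Q (unit_exp l) * P (unit_exp i))
      - of_nat (if i = l then 2 else 1) * G (unit_exp i + unit_exp l)" for i l
    unfolding V_def minus_apply mps_mult_const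
    by (simp add: mps_mult_nth_unit P(2) Q(2) mps_deriv_0_nth mps_deriv_unit_exp del: One_nat_def)
  \<comment> \<open>The contribution of \<open>G\<close> is symmetric and cancels; what remains is
    \<open>1 + \<kappa>\<close> times the 2 by 2 minor of the linear coefficients.\<close>
  have "V i (unit_exp l) = V l (unit_exp i)" by (rule curl[OF VPS V0 il])
  then have "(1 + \<kappa>) * (P (unit_exp i) * Q (unit_exp l)) = (1 + \<kappa>) * (P (unit_exp l) * Q (unit_exp i))"
    unfolding Vl by (simp add: add.commute eq_commute[of i l] algebra_simps del: One_nat_def)
  moreover have "1 + \<kappa> \<noteq> 0"
  proof
    assume "1 + \<kappa> = 0"
    then have "of_nat (d + e) = (0 :: 'k)" using P(7) by (simp add: \<kappa>_def field_simps)
    then show False using P(7) by (simp only: of_nat_eq_0_iff)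
  qed
  ultimately show ?thesis by simp
qed

text \<open>The minor of linear coefficients is bilinear and vanishes on pairs from
  \<open>T\<close>. Both \<open>X_0\<close> and \<open>X_1\<close> are sums of elements of
  \<open>T\<close>, yet their minor is 1.\<close>

lemma eigenvector_contradiction:
  fixes x :: "nat \<Rightarrow> 'k::field_char_0 fps" and S :: "'k fps set"
  assumes point: "fps_point n x" and n: "2 \<le> n"
    and curl: "\<And>V i l. (\<And>i. i < n \<Longrightarrow> V i \<in> PS n) \<Longrightarrow>
      (\<Sum>i<n. ev n x (V i) * fps_deriv (x i)) = 0 \<Longrightarrow> i < n \<Longrightarrow> l < n \<Longrightarrow>
      V i (unit_exp l) = V l (unit_exp i)"
    and ac: "0 < a" "2 * a \<le> c"
    and order: "\<And>F. F \<in> PS n \<Longrightarrow> F 0 = 0 \<Longrightarrow> fps_X ^ a dvd ev n x F"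
    and cond: "\<And>h. \<exists>G\<in>PS n. G 0 = 0 \<and> (\<forall>i. G (unit_exp i) = 0) \<and> fps_X ^ c * h = ev n x G"
    and S: "\<And>g. g \<in> S \<Longrightarrow> \<exists>r \<tau>. r \<in> ev n x ` PS n \<and> fps_X ^ (c - a) dvd \<tau> \<and> g = r + \<tau>"
    and xS: "\<And>i. i < n \<Longrightarrow> x i \<in> S"
    and eig: "\<And>g K. g \<in> S \<Longrightarrow> \<exists>L z. z 0 = fps_const (g $ 0) \<and>
      (\<forall>d. z d \<in> S \<and> (0 < d \<longrightarrow> z d $ 0 = 0) \<and>
        \<epsilon> * fps_to_fls (fps_deriv (z d)) = of_nat d * fps_to_fls (z d)) \<and>
      fps_X ^ K dvd g - (\<Sum>d<L. z d)"
  shows False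
proof -
  interpret fps_point n x by (rule point)
  define T where "T P \<longleftrightarrow> P \<in> PS n \<and> P 0 = 0 \<and> (\<exists>z \<tau> d. ev n x P = z + \<tau> \<and> fps_X ^ a dvd z \<and>
    fps_X ^ (c - a) dvd \<tau> \<and> \<epsilon> * fps_to_fls (fps_deriv z) = of_nat d * fps_to_fls z \<and> 0 < d)" for P
  have wedge: "P (unit_exp 0) * Q (unit_exp 1) = P (unit_exp 1) * Q (unit_exp 0)" if TPQ: "T P" "T Q" for P Q
  proof -
    obtain z \<tau> d where P: "P \<in> PS n" "P 0 = 0" "ev n x P = z + \<tau>" "fps_X ^ a dvd z" "fps_X ^ (c - a) dvd \<tau>"
      "\<epsilon> * fps_to_fls (fps_deriv z) = of_nat d * fps_to_fls z" "0 < d"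
      using TPQ(1) unfolding T_def by blast
    obtain w \<sigma> e where Q: "Q \<in> PS n" "Q 0 = 0" "ev n x Q = w + \<sigma>" "fps_X ^ a dvd w" "fps_X ^ (c - a) dvd \<sigma>"
      "\<epsilon> * fps_to_fls (fps_deriv w) = of_nat e * fps_to_fls w" "0 < e"
      using TPQ(2) unfolding T_def by blast
    show ?thesis
      by (rule eigenvector_wedge[OF point curl ac cond P Q]) (use n in auto)
  qed
  have aca: "a \<le> c - a" using ac by simp
  have var_sum: "\<exists>(A :: nat set) P. mps_var i = (\<Sum>d\<in>A. P d) \<and> (\<forall>d\<in>A. T (P d))" if i: "i < n" for i
  proof -
    obtain L z where z0: "z 0 = fps_const (x i $ 0)"
      and z: "\<And>d. z d \<in> S" "\<And>d. 0 < d \<Longrightarrow> z d $ 0 = 0"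
        "\<And>d. \<epsilon> * fps_to_fls (fps_deriv (z d)) = of_nat d * fps_to_fls (z d)"
      and zL: "fps_X ^ (c - a) dvd x i - (\<Sum>d<L. z d)"
      using eig[OF xS[OF i], of "c - a"] by blast
    have "\<forall>d. \<exists>P \<tau>. P \<in> PS n \<and> fps_X ^ (c - a) dvd \<tau> \<and> z d = ev n x P + \<tau>"
      using S[OF z(1)] by blast
    then obtain P \<tau> where P: "\<And>d. P d \<in> PS n" "\<And>d. fps_X ^ (c - a) dvd \<tau> d" "\<And>d. z d = ev n x (P d) + \<tau> d"
      by metis
    have \<tau>0: "\<tau> d $ 0 = 0" for d
      using P(2)[of d] ac aca by (auto simp: fps_X_power_dvd_iff)
    have P0: "P d 0 = 0" if "0 < d" for d
      using z(2)[OF that] P(3)[of d] \<tau>0[of d] by (simp flip: ev_nth_0)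
    have TP: "T (P d)" if d: "0 < d" for d
    proof -
      have "fps_X ^ a dvd \<tau> d" using dvd_trans[OF le_imp_power_dvd[OF aca] P(2)] .
      then have "fps_X ^ a dvd z d" using order[OF P(1) P0[OF d]] by (simp add: P(3))
      moreover have "ev n x (P d) = z d + - \<tau> d" using P(3)[of d] by simp
      moreover have "fps_X ^ (c - a) dvd - \<tau> d" using P(2) by simp
      ultimately show ?thesis unfolding T_def using P(1) P0[OF d] z(3) d by blast
    qed
    \<comment> \<open>Index 0 is free because \<open>z 0\<close> is the constant term of
      \<open>x i\<close>, which is 0. The remainder stored there has its value in
      \<open>t^(c-a) k[[t]]\<close>, so it satisfies \<open>T\<close> with the eigenvector
      0.\<close>
    define P' where "P' d = (if d = 0 then mps_var i - (\<Sum>d\<in>{1..<L}. P d) else P d)" for d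
    have PPS: "mps_var i - (\<Sum>d\<in>{1..<L}. P d) \<in> PS n" by (intro PS_diff PS_var PS_sum P i)
    have "(\<Sum>d<L. z d) = (\<Sum>d\<in>{1..<L}. z d)"
      using z0 x_nth_0[OF i] by (intro sum.mono_neutral_right) (auto simp: Suc_le_eq)
    then have "ev n x (mps_var i - (\<Sum>d\<in>{1..<L}. P d)) = (x i - (\<Sum>d<L. z d)) + (\<Sum>d\<in>{1..<L}. \<tau> d)"
      by (simp add: ev_diff ev_sum ev_var[OF i] P(3) sum.distrib)
    then have "fps_X ^ (c - a) dvd ev n x (mps_var i - (\<Sum>d\<in>{1..<L}. P d))"
      using zL P(2) by (auto intro!: dvd_add dvd_sum)
    moreover have "(mps_var i - (\<Sum>d\<in>{1..<L}. P d)) 0 = 0"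
      using P0 by (simp add: sum_fun_apply mps_var_nth_0)
    ultimately have "T (P' 0)"
      unfolding T_def using PPS
      by (simp add: P'_def) (rule exI[of _ 0], rule exI[of _ "ev n x (mps_var i - (\<Sum>d\<in>{1..<L}. P d))"], auto)
    moreover have "T (P' d)" if "0 < d" for d using TP[OF that] that by (simp add: P'_def)
    ultimately have "T (P' d)" for d by (cases "d = 0") auto
    moreover have "mps_var i = (\<Sum>d\<in>insert 0 {1..<L}. P' d)"
      by (simp add: P'_def)
    ultimately show ?thesis by blast
  qed
  have n01: "0 < n" "1 < n" using n by auto
  obtain A0 :: "nat set" and P0 where P0: "mps_var 0 = (\<Sum>d\<in>A0. P0 d)" "\<forall>d\<in>A0. T (P0 d)" using var_sum[OF n01(1)] by blast
  obtain A1 :: "nat set" and P1 where P1: "mps_var 1 = (\<Sum>d\<in>A1. P1 d)" "\<forall>d\<in>A1. T (P1 d)" using var_sum[OF n01(2)] by blast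
  have c: "mps_var i (unit_exp j) = (if i = j then 1 else 0 :: 'k)" for i j
  proof -
    have "unit_exp j = unit_exp i \<longleftrightarrow> i = j"
      by (metis lookup_single_eq lookup_single_not_eq one_neq_zero)
    then show ?thesis by (simp add: mps_var_def del: One_nat_def)
  qed
  have "mps_var 0 (unit_exp 0) * mps_var 1 (unit_exp 1) = mps_var 0 (unit_exp 1) * (mps_var 1 (unit_exp 0) :: 'k)"
    unfolding P0(1) P1(1) sum_fun_apply sum_product
    by (intro sum.cong refl wedge) (use P0(2) P1(2) in auto)
  then show False unfolding c by simp
qed

section \<open>Orders of values, and assembly of the proof\<close>

lemma fls_ring_a_inv: "a_inv fls_ring (q :: 'k::field fls) = - q"
proof -
  interpret cring "fls_ring :: 'k fls ring"
    unfolding fls_ring_def by (rule cring_from_type_algebra)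
  show ?thesis
    by (rule minus_equality) (simp_all add: fls_ring_def ring_of_type_algebra_def)
qed

context fps_point
begin

lemma R0_dim_0:
  assumes "n = 0" "h \<in> R0"
  shows "\<exists>c. h = fps_const c"
proof -
  obtain G where G: "G \<in> PS n" "h = ev n x G" using assms(2) by blast
  have "u = 0" if "G u \<noteq> 0" for u
    using G(1) that assms(1) by (auto simp: PS_iff)
  then have eq: "G = mps_const (G 0)" by (auto simp: mps_const_def fun_eq_iff)
  have "h = ev n x (mps_const (G 0))" using G(2) arg_cong[OF eq, of "ev n x"] by (rule trans)
  then show ?thesis by (simp add: ev_const)
qed

text \<open>Each variable split off contributes order \<open>a\<close>; without linear part two can
  be split off. This turns the hypothesis on the conductor into
  \<open>2 * a 0 \<le> c\<close>.\<close>

lemma ev_order: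
  assumes dvd: "\<And>i. i < n \<Longrightarrow> fps_X ^ a dvd x i" and F: "F \<in> PS n" "F 0 = 0"
  shows "fps_X ^ a dvd ev n x F"
    and "(\<And>i. F (unit_exp i) = 0) \<Longrightarrow> fps_X ^ (2 * a) dvd ev n x F"
proof -
  have one: "\<exists>G. (\<forall>i<n. G i \<in> PS n \<and> (F (unit_exp i) = 0 \<longrightarrow> G i 0 = 0)) \<and>
      ev n x F = (\<Sum>i<n. x i * ev n x (G i))" if F: "F \<in> PS n" "F 0 = 0" for F
  proof -
    obtain G where G: "\<forall>i<n. G i \<in> PS n" "F = mps_const (F 0) + (\<Sum>i<n. mps_mult (mps_var i) (G i))"
      "\<forall>i u. G i u \<noteq> 0 \<longrightarrow> F (u + unit_exp i) \<noteq> 0"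
      using mps_decomp[OF F(1)] by blast
    have "F = (\<Sum>i<n. mps_mult (mps_var i) (G i))"
      using G(2) unfolding F(2) mps_const_0 add_0 .
    then have "ev n x F = ev n x (\<Sum>i<n. mps_mult (mps_var i) (G i))" by (rule arg_cong)
    also have "\<dots> = (\<Sum>i<n. x i * ev n x (G i))"
      unfolding ev_sum by (rule sum.cong) (simp_all add: ev_mult ev_var)
    finally have "ev n x F = (\<Sum>i<n. x i * ev n x (G i))" .
    moreover have "F (unit_exp i) = 0 \<longrightarrow> G i 0 = 0" for i
      using G(3)[rule_format, of i 0] by (auto simp del: One_nat_def)
    ultimately show ?thesis using G(1) by blast
  qed
  have first: "fps_X ^ a dvd ev n x F" if F: "F \<in> PS n" "F 0 = 0" for F
    using one[OF F] dvd by (auto intro!: dvd_sum)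
  show "fps_X ^ a dvd ev n x F" by (rule first[OF F])
  show "fps_X ^ (2 * a) dvd ev n x F" if lin: "\<And>i. F (unit_exp i) = 0"
  proof -
    obtain G where G: "\<forall>i<n. G i \<in> PS n \<and> (F (unit_exp i) = 0 \<longrightarrow> G i 0 = 0)"
      "ev n x F = (\<Sum>i<n. x i * ev n x (G i))" using one[OF F] by blast
    have "fps_X ^ a * fps_X ^ a dvd x i * ev n x (G i)" if "i < n" for i
      using G(1) lin that by (intro mult_dvd_mono dvd first) auto
    then show ?thesis unfolding G(2) mult_2 power_add by (intro dvd_sum) auto
  qed
qed

end

lemma fraction_field_X:
  fixes A :: "'k::field fps set"
  assumes "range fps_to_fls \<subseteq> fraction_field (fps_to_fls ` A)"
  shows "\<exists>g\<in>A. g \<noteq> 0 \<and> g * fps_X \<in> A"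
proof -
  have "fps_to_fls fps_X \<in> fraction_field (fps_to_fls ` A)" using assms by blast
  then obtain f g where fg: "f \<in> A" "g \<in> A" "fps_to_fls g \<noteq> 0"
    "fps_to_fls fps_X = fps_to_fls f / fps_to_fls g"
    unfolding fraction_field_def by blast
  then have "fps_to_fls (g * fps_X) = fps_to_fls f"
    by (simp add: fls_times_fps_to_fls field_simps)
  then have "g * fps_X = f" by (simp only: fps_to_fls_eq_iff)
  then show ?thesis using fg by auto
qed

theorem theorem4p11:
  fixes \<alpha> :: "nat \<Rightarrow> 'k::{alg_closed_field, field_char_0} fps"
    and a :: "nat \<Rightarrow> nat"
    and n m :: nat
    and x :: "nat \<Rightarrow> 'k fps"
    and f :: "nat \<Rightarrow> 'k mps"
    and R S :: "'k fls set"
    and I :: "'k mps set"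
  assumes units: "\<And>i. i < n \<Longrightarrow> \<alpha> i dvd 1"
    and exponents_pos: "\<And>i. i < n \<Longrightarrow> 0 < a i"
    and exponents_mono: "\<And>i j. i \<le> j \<Longrightarrow> j < n \<Longrightarrow> a i \<le> a j"
    and x: "\<And>i. i < n \<Longrightarrow> x i = \<alpha> i * fps_X ^ a i"
    and R: "R = power_series_subring n x"
    and normalization: "integral_closure R = range fps_to_fls"
    and embedding_dim: "embedding_dim (fls_subring R) = n"
    and min_gens: "minimal_generators (fls_subring R) (max_ideal (fls_subring R)) n
                     (\<lambda>i. fps_to_fls (x i))"
    and I: "I = a_kernel (mps_ring n) (fls_subring R) (mps_eval x)"
    and I_gens: "\<And>j. j < m \<Longrightarrow> f j \<in> carrier (mps_ring n)"
                "I = genideal (mps_ring n) (f ` {..<m})"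
    and I_subset: "I \<subseteq> ideal_prod (mps_ring n)
                          (genideal (mps_ring n) (mps_var ` {..<n}))
                          (genideal (mps_ring n) (mps_var ` {..<n}))"
    and conductor: "conductor R \<subseteq> ideal_prod (fls_subring R)
                          (max_ideal (fls_subring R)) (max_ideal (fls_subring R))"
    and S: "S = generate_ring fls_ring (R \<union> {z / fps_to_fls (x 0) | z. z \<in> conductor R})"
    and quasi_hom: "quasi_homogeneous fls_const (fls_subring S)"
  shows "torsion_submodule (fls_subring R) (differentials n m x f)
           \<noteq> {\<zero>\<^bsub>differentials n m x f\<^esub>}"
proof
  assume torsion: "torsion_submodule (fls_subring R) (differentials n m x f)
           = {\<zero>\<^bsub>differentials n m x f\<^esub>}"
  have \<alpha>0: "\<alpha> i $ 0 \<noteq> 0" if "i < n" for i using units[OF that] by simp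
  have x0: "x i $ 0 = 0" if "i < n" for i
    using x[OF that] exponents_pos[OF that] by (simp add: fps_mult_nth_0 fps_nth_power_0)
  have point: "fps_point n x" by unfold_locales (rule x0)
  then interpret fps_point n x .
  interpret cring "mps_ring n :: 'k mps ring" by (rule cring_mps_ring)
  have R0: "R = fps_to_fls ` R0" unfolding R by (rule power_series_subring_eq)
  have memR: "fps_to_fls g \<in> R \<longleftrightarrow> g \<in> R0" for g unfolding R0 by (simp add: inj_image_mem_iff inj_def)
  have "range fps_to_fls \<subseteq> fraction_field R"
    unfolding normalization[symmetric] by (auto simp: integral_closure_def)
  then have sub: "range fps_to_fls \<subseteq> fraction_field (fps_to_fls ` R0)"
    unfolding R0 .
  obtain g where g: "g \<in> R0" "g \<noteq> 0" "g * fps_X \<in> R0"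
    using fraction_field_X[OF sub] by metis
  have "n \<noteq> 0"
  proof (rule notI)
    assume n: "n = 0"
    obtain c where c: "g = fps_const c" using R0_dim_0[OF n g(1)] by blast
    obtain d where d: "g * fps_X = fps_const d" using R0_dim_0[OF n g(3)] by blast
    have "(g * fps_X) $ 1 = c" by (simp add: c)
    then have "c = 0" by (simp add: d)
    then show False using g(2) c by simp
  qed
  then have n0: "0 < n" by simp
  have a0: "0 < a 0" using exponents_pos n0 .
  have dvd_x: "fps_X ^ a 0 dvd x i" if "i < n" for i
    using exponents_mono[OF _ that] x[OF that] by (simp add: le_imp_power_dvd)
  obtain N where "\<And>h. fps_X ^ N * h \<in> R0"
    using conductor_nonzero[OF n0 a0 x[OF n0] \<alpha>0[OF n0] g] by blast
  then have exN: "\<exists>c. \<forall>h. fps_X ^ c * h \<in> R0" by blast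
  \<comment> \<open>The conductor will be \<open>t^c k[[t]]\<close>.\<close>
  define c where "c = (LEAST c. \<forall>h. fps_X ^ c * h \<in> R0)"
  have cR: "fps_X ^ c * h \<in> R0" for h using LeastI_ex[OF exN] by (simp add: c_def)
  have c_least: "c \<le> d" if "\<And>h. fps_X ^ d * h \<in> R0" for d
    unfolding c_def by (rule Least_le) (use that in blast)
  have cond_mem: "fps_to_fls (fps_X ^ c * h) \<in> conductor R" for h
  proof -
    have one: "1 \<in> R" using memR[of 1] R0_const[of 1] by simp
    have "fps_to_fls (fps_X ^ c * h) \<in> fraction_field R"
      unfolding fraction_field_def using one memR cR[of h]
      by (intro CollectI exI[of _ "fps_to_fls (fps_X ^ c * h)"] exI[of _ 1]) auto
    moreover have "fps_to_fls (fps_X ^ c * h) * fps_to_fls b \<in> R" for b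
      using cR[of "h * b"] memR[of "fps_X ^ c * h * b"] by (simp add: fls_times_fps_to_fls mult.assoc)
    ultimately show ?thesis unfolding conductor_def normalization by blast
  qed
  have cond_form: "\<exists>h. q = fps_to_fls (fps_X ^ c * h)" if "q \<in> conductor R" for q
  proof -
    have q: "q * fps_to_fls b \<in> R" for b using that unfolding conductor_def normalization by blast
    obtain h where h: "q = fps_to_fls h" using q[of 1] R0 by auto
    have hR: "h * b \<in> R0" for b using q[of b] memR[of "h * b"] by (simp add: h fls_times_fps_to_fls)
    \<comment> \<open>The power of \<open>t\<close> with the order of \<open>h\<close> is a multiple
      of \<open>h\<close>, so all its multiples lie in \<open>R0\<close>; minimality of
      \<open>c\<close> bounds the order below.\<close>
    have "fps_X ^ c dvd h"
    proof (cases "h = 0")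
      case False
      then have "h dvd fps_X ^ subdegree h" by (simp add: fps_dvd_iff)
      then obtain e where "fps_X ^ subdegree h = h * e" by (rule dvdE)
      then have "fps_X ^ subdegree h * b \<in> R0" for b using hR[of "e * b"] by (simp add: mult.assoc)
      then have "c \<le> subdegree h" by (rule c_least)
      then show ?thesis using False by (simp add: fps_dvd_iff)
    qed simp
    then show ?thesis using h by (auto elim!: dvdE)
  qed
  have cond: "\<exists>G\<in>PS n. G 0 = 0 \<and> (\<forall>i. G (unit_exp i) = 0) \<and> fps_X ^ c * h = ev n x G" for h
  proof -
    have "fps_to_fls (fps_X ^ c * h) \<in> ideal_prod (fls_subring (fps_to_fls ` R0))
      (max_ideal (fls_subring (fps_to_fls ` R0))) (max_ideal (fls_subring (fps_to_fls ` R0)))"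
      using cond_mem conductor unfolding R0 by blast
    from max_ideal_square_subset[OF this] show ?thesis by (simp only: fps_to_fls_eq_iff)
  qed
  have ac: "2 * a 0 \<le> c"
  proof -
    obtain G where G: "G \<in> PS n" "G 0 = 0" "\<forall>i. G (unit_exp i) = 0" "fps_X ^ c * 1 = ev n x G"
      using cond[of 1] by blast
    have "fps_X ^ (2 * a 0) dvd (fps_X ^ c :: 'k fps)"
      using ev_order(2)[OF dvd_x G(1,2)] G(3,4) by simp
    then show ?thesis by (simp add: fps_dvd_iff)
  qed
  \<comment> \<open>With a single generator, \<open>t^c k[[t]]\<close> would lie in
    \<open>x_0 R\<close>; division by \<open>x_0\<close> puts \<open>t^(c-a) k[[t]]\<close> into
    \<open>R\<close>, against the minimality of \<open>c\<close>.\<close>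
  have n2: "2 \<le> n"
  proof (rule ccontr)
    assume "\<not> 2 \<le> n"
    then have n1: "n = 1" using n0 by simp
    have "fps_X ^ (c - a 0) * h \<in> R0" for h
    proof -
      obtain G where G: "G \<in> PS n" "G 0 = 0" "fps_X ^ c * (\<alpha> 0 * h) = ev n x G"
        using cond[of "\<alpha> 0 * h"] by blast
      obtain H where H: "\<forall>i<n. H i \<in> PS n" "G = mps_const (G 0) + (\<Sum>i<n. mps_mult (mps_var i) (H i))"
        using mps_decomp[OF G(1)] by blast
      have "G = mps_mult (mps_var 0) (H 0)"
        using H(2) unfolding G(2) mps_const_0 add_0 n1 by simp
      then have "ev n x G = ev n x (mps_mult (mps_var 0) (H 0))" by (rule arg_cong)
      then have "fps_X ^ c * (\<alpha> 0 * h) = x 0 * ev n x (H 0)"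
        using G(3) by (simp add: ev_mult ev_var[OF n0])
      moreover have "fps_X ^ a 0 * fps_X ^ (c - a 0) = (fps_X ^ c :: 'k fps)"
        using ac by (simp flip: power_add)
      then have "x 0 * (fps_X ^ (c - a 0) * h) = fps_X ^ c * (\<alpha> 0 * h)"
        unfolding x[OF n0] by (metis mult.assoc mult.left_commute)
      ultimately have "x 0 * (fps_X ^ (c - a 0) * h) = x 0 * ev n x (H 0)"
        by simp
      moreover have "x 0 \<noteq> 0" using x[OF n0] \<alpha>0[OF n0] by auto
      ultimately have "fps_X ^ (c - a 0) * h = ev n x (H 0)" by simp
      then show ?thesis using H(1) n0 by blast
    qed
    then have "c \<le> c - a 0" by (rule c_least)
    then show False using ac a0 by simp
  qed
  \<comment> \<open>The sum of \<open>R\<close> and \<open>t^(c-a) k[[t]]\<close> is closed under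
    products because the second summand is an ideal of all of \<open>k[[t]]\<close>.\<close>
  have S_form: "\<exists>r \<tau>. r \<in> R0 \<and> fps_X ^ (c - a 0) dvd \<tau> \<and> q = fps_to_fls (r + \<tau>)" if "q \<in> S" for q
    using that unfolding S
  proof (induction rule: generate_ring.induct)
    case one
    show ?case
      using R0_const[of 1]
      by (intro exI[of _ 1] exI[of _ 0]) (simp add: fls_ring_def ring_of_type_algebra_def)
  next
    case (incl q)
    then show ?case
    proof
      assume "q \<in> R"
      then obtain r where "r \<in> R0" "q = fps_to_fls r" unfolding R0 by blast
      then show ?thesis by (intro exI[of _ r] exI[of _ 0]) simp
    next
      assume "q \<in> {z / fps_to_fls (x 0) | z. z \<in> conductor R}"
      then obtain h where h: "q = fps_to_fls (fps_X ^ c * h) / fps_to_fls (x 0)"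
        using cond_form by blast
      have unit: "\<alpha> 0 * inverse (\<alpha> 0) = 1" using \<alpha>0[OF n0] by (simp add: inverse_mult_eq_1')
      have split: "fps_X ^ a 0 * fps_X ^ (c - a 0) = (fps_X ^ c :: 'k fps)"
        using ac by (simp flip: power_add)
      have "x 0 * (fps_X ^ (c - a 0) * (h * inverse (\<alpha> 0))) =
          (\<alpha> 0 * inverse (\<alpha> 0)) * (fps_X ^ a 0 * fps_X ^ (c - a 0)) * h"
        unfolding x[OF n0] by (simp only: mult_ac)
      then have e: "fps_X ^ c * h = x 0 * (fps_X ^ (c - a 0) * (h * inverse (\<alpha> 0)))"
        unfolding unit split mult_1 by (rule sym)
      moreover have "x 0 \<noteq> 0" using x[OF n0] \<alpha>0[OF n0] by auto
      ultimately have "q = fps_to_fls (fps_X ^ (c - a 0) * (h * inverse (\<alpha> 0)))"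
        unfolding h e by (simp add: fls_times_fps_to_fls)
      then show ?thesis
        using R0_const[of 0] by (intro exI[of _ 0] exI[of _ "fps_X ^ (c - a 0) * (h * inverse (\<alpha> 0))"]) simp
    qed
  next
    case (a_inv q)
    then obtain r \<tau> where "r \<in> R0" "fps_X ^ (c - a 0) dvd \<tau>" "q = fps_to_fls (r + \<tau>)" by blast
    then show ?case
      by (intro exI[of _ "- r"] exI[of _ "- \<tau>"]) (simp add: R0_uminus fls_ring_a_inv)
  next
    case (eng_add p q)
    then obtain r \<tau> r' \<tau>' where "r \<in> R0" "fps_X ^ (c - a 0) dvd \<tau>" "p = fps_to_fls (r + \<tau>)"
      "r' \<in> R0" "fps_X ^ (c - a 0) dvd \<tau>'" "q = fps_to_fls (r' + \<tau>')" by blast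
    then show ?case
      by (intro exI[of _ "r + r'"] exI[of _ "\<tau> + \<tau>'"])
         (simp add: R0_add fls_ring_def ring_of_type_algebra_def)
  next
    case (eng_mult p q)
    then obtain r \<tau> r' \<tau>' where "r \<in> R0" "fps_X ^ (c - a 0) dvd \<tau>" "p = fps_to_fls (r + \<tau>)"
      "r' \<in> R0" "fps_X ^ (c - a 0) dvd \<tau>'" "q = fps_to_fls (r' + \<tau>')" by blast
    then show ?case
      by (intro exI[of _ "r * r'"] exI[of _ "r * \<tau>' + \<tau> * r' + \<tau> * \<tau>'"])
         (simp add: R0_mult fls_ring_def ring_of_type_algebra_def fls_times_fps_to_fls algebra_simps)
  qed
  have RS: "R \<subseteq> S" unfolding S by (auto intro: generate_ring.incl)
  have S_sub: "S \<subseteq> range fps_to_fls" using S_form by blast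
  have S_mem: "fps_to_fls (fps_X ^ c * h) \<in> S" for h using cR[of h] memR RS by blast
  obtain \<epsilon> where eig: "\<And>g K. fps_to_fls g \<in> S \<Longrightarrow> \<exists>L z. z 0 = fps_const (g $ 0) \<and>
      (\<forall>d. fps_to_fls (z d) \<in> S \<and> (0 < d \<longrightarrow> z d $ 0 = 0) \<and>
        \<epsilon> * fps_to_fls (fps_deriv (z d)) = of_nat d * fps_to_fls (z d)) \<and>
      fps_X ^ K dvd g - (\<Sum>d<L. z d)"
    using quasi_homogeneous_eigenvectors[OF quasi_hom S_sub S_mem] by blast
  have I_eq: "I = {F \<in> PS n. ev n x F = 0}"
    unfolding I a_kernel_def' by (auto simp: fls_subring_simps mps_eval_eq_ev)
  have I_low: "F 0 = 0 \<and> (\<forall>i. F (unit_exp i) = 0)" if "F \<in> PS n" "ev n x F = 0" for F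
    by (rule ideal_vars_square_subset, rule subsetD[OF I_subset]) (use that in \<open>simp add: I_eq\<close>)
  have f_I: "ev n x (f j) = 0" if "j < m" for j
  proof -
    have "f ` {..<m} \<subseteq> PS n" using I_gens(1) by blast
    then have "f ` {..<m} \<subseteq> I" unfolding I_gens(2) by (rule genideal_self)
    then have "f j \<in> I" using that by blast
    then show ?thesis by (simp add: I_eq)
  qed
  have torsion_free: "\<exists>W. (\<forall>j<m. W j \<in> R0) \<and> (\<forall>i<n. v i = (\<Sum>j<m. ev n x (mps_deriv i (f j)) * W j))"
    if v: "\<And>i. i < n \<Longrightarrow> v i \<in> R0" "(\<Sum>i<n. v i * fps_deriv (x i)) = 0" for v
  proof -
    define J where "J = jacobian_matrix n m x f"
    define B where "B = mult_mat_vec J ` carrier (free_module R m)"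
    have J: "J \<in> carrier_mat n m" by (simp add: J_def jacobian_matrix_def)
    have Jmult: "vec_index (J *\<^sub>v vec m (\<lambda>j. fps_to_fls (W j))) i =
        fps_to_fls (\<Sum>j<m. ev n x (mps_deriv i (f j)) * W j)" if "i < n" for W i
      using that I_gens(1)
      by (simp add: J_def jacobian_matrix_def scalar_prod_def mps_eval_eq_ev PS_deriv fps_to_fls_sum
          fls_times_fps_to_fls lessThan_atLeast0)
    \<comment> \<open>Only after multiplication by \<open>r\<close> is \<open>v\<close> known to be
      a combination of the columns; its class is thus torsion, and the assumption on torsion removes
      \<open>r\<close>.\<close>
    obtain r W where r: "r \<in> R0" "r \<noteq> 0" and W: "\<And>j. j < m \<Longrightarrow> W j \<in> R0"
      "\<And>i. i < n \<Longrightarrow> r * v i = (\<Sum>j<m. ev n x (mps_deriv i (f j)) * W j)"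
      using jacobian_span[OF cR I_eq I_gens v(2)] by blast
    have "vec n (\<lambda>i. fps_to_fls (v i)) \<in> B"
    proof (rule torsion_free_cokernel[OF _ _ _ _ J B_def])
      show "torsion_submodule (fls_subring R) (quotient_module (free_module R n) B) =
          {\<zero>\<^bsub>quotient_module (free_module R n) B\<^esub>}"
        using torsion by (simp add: differentials_def Let_def B_def J_def flip: R)
      show "vec n (\<lambda>i. fps_to_fls (v i)) \<in> carrier (free_module R n)"
        using v(1) memR by (simp add: free_module_def)
      have "fps_to_fls r \<cdot>\<^sub>v vec n (\<lambda>i. fps_to_fls (v i)) = J *\<^sub>v vec m (\<lambda>j. fps_to_fls (W j))"
      proof (rule eq_vecI)
        fix i assume "i < dim_vec (J *\<^sub>v vec m (\<lambda>j. fps_to_fls (W j)))"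
        then have i: "i < n" using J by simp
        show "vec_index (fps_to_fls r \<cdot>\<^sub>v vec n (\<lambda>i. fps_to_fls (v i))) i =
            vec_index (J *\<^sub>v vec m (\<lambda>j. fps_to_fls (W j))) i"
          unfolding Jmult[OF i] W(2)[OF i, symmetric] using i by (simp add: fls_times_fps_to_fls)
      qed (use J in simp)
      moreover have "vec m (\<lambda>j. fps_to_fls (W j)) \<in> carrier (free_module R m)"
        using W(1) memR by (simp add: free_module_def)
      ultimately show "fps_to_fls r \<cdot>\<^sub>v vec n (\<lambda>i. fps_to_fls (v i)) \<in> B" unfolding B_def by blast
      show "fps_to_fls r \<in> R" "fps_to_fls r \<noteq> 0" using r memR by simp_all
      show "p + q \<in> R" "p * q \<in> R" if pq: "p \<in> R" "q \<in> R" for p q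
      proof -
        obtain p' q' where p': "p' \<in> R0" "p = fps_to_fls p'" and q': "q' \<in> R0" "q = fps_to_fls q'"
          using pq unfolding R0 by blast
        show "p + q \<in> R" "p * q \<in> R"
          using memR[of "p' + q'"] memR[of "p' * q'"] R0_add[OF p'(1) q'(1)] R0_mult[OF p'(1) q'(1)]
          by (simp_all add: p'(2) q'(2) fls_times_fps_to_fls)
      qed
      show "0 \<in> R" "- 1 \<in> R"
        using memR[of 0] memR[of "- 1"] R0_const[of 0] R0_uminus[OF R0_const[of 1]] by simp_all
    qed
    then obtain w where w: "w \<in> carrier_vec m" "\<forall>j<m. vec_index w j \<in> R"
      "vec n (\<lambda>i. fps_to_fls (v i)) = J *\<^sub>v w"
      unfolding B_def by (auto simp: free_module_def)
    define W' where "W' j = fls_regpart (vec_index w j)" for j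
    have W': "vec_index w j = fps_to_fls (W' j)" "W' j \<in> R0" if j: "j < m" for j
    proof -
      have "vec_index w j \<in> fps_to_fls ` R0" using w(2) j unfolding R0 by blast
      then obtain h where h: "h \<in> R0" "vec_index w j = fps_to_fls h" by blast
      then show "vec_index w j = fps_to_fls (W' j)" "W' j \<in> R0" by (simp_all add: W'_def)
    qed
    have "w = vec m (\<lambda>j. fps_to_fls (W' j))" using w(1) W' by (intro eq_vecI) auto
    then have e: "vec n (\<lambda>i. fps_to_fls (v i)) = J *\<^sub>v vec m (\<lambda>j. fps_to_fls (W' j))" using w(3) by simp
    have "v i = (\<Sum>j<m. ev n x (mps_deriv i (f j)) * W' j)" if i: "i < n" for i
    proof -
      have "fps_to_fls (v i) = fps_to_fls (\<Sum>j<m. ev n x (mps_deriv i (f j)) * W' j)"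
        using arg_cong[OF e, of "\<lambda>u. vec_index u i"] i by (simp only: index_vec Jmult)
      then show ?thesis by (simp only: fps_to_fls_eq_iff)
    qed
    then show ?thesis using W'(2) by blast
  qed
  show False
  proof (rule eigenvector_contradiction[OF point n2 _ a0 ac _ cond, where S = "{g. fps_to_fls g \<in> S}"])
    fix V i l assume "\<And>i. i < n \<Longrightarrow> V i \<in> PS n" "(\<Sum>i<n. ev n x (V i) * fps_deriv (x i)) = 0" "i < n" "l < n"
    then show "V i (unit_exp l) = V l (unit_exp i)"
      by (intro relation_curl_free[OF I_low I_gens(1) f_I torsion_free]) auto
  next
    show "fps_X ^ a 0 dvd ev n x F" if "F \<in> PS n" "F 0 = 0" for F
      by (rule ev_order(1)[OF dvd_x that])
  next
    fix g assume "g \<in> {g. fps_to_fls g \<in> S}"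
    then obtain r \<tau> where "r \<in> R0" "fps_X ^ (c - a 0) dvd \<tau>" "fps_to_fls g = fps_to_fls (r + \<tau>)"
      using S_form by blast
    then show "\<exists>r \<tau>. r \<in> R0 \<and> fps_X ^ (c - a 0) dvd \<tau> \<and> g = r + \<tau>"
      unfolding fps_to_fls_eq_iff by blast
  next
    show "x i \<in> {g. fps_to_fls g \<in> S}" if "i < n" for i using R0_var[OF that] memR RS by blast
  next
    fix g K assume "g \<in> {g. fps_to_fls g \<in> S}"
    then show "\<exists>L z. z 0 = fps_const (g $ 0) \<and>
      (\<forall>d. z d \<in> {g. fps_to_fls g \<in> S} \<and> (0 < d \<longrightarrow> z d $ 0 = 0) \<and>
        \<epsilon> * fps_to_fls (fps_deriv (z d)) = of_nat d * fps_to_fls (z d)) \<and>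
      fps_X ^ K dvd g - (\<Sum>d<L. z d)"
      using eig[of g K] by simp
  qed
qed

end
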